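(* Let $G$ be a (topologically) finitely generated profinite group with positive rank gradient, i.e. $RG(G)>0$. Then $G$ does not satisfy a nontrivial group law.
   Context: For a profinite group $H$, $d(H)$ denotes the minimal number of topological generators of $H$. The rank gradient of a finitely generated profinite group $G$ is $$RG(G)=\inf\left\{\frac{d(H)-1}{|G:H|}\ \middle|\ H \text{ an open subgroup of } G\right\}.$$ Equivalently, $RG(G)=\lim_{i\to\infty}\frac{d(H_i)-1}{|G:H_i|}$ for any chain $H_1\ge H_2\ge\cdots$ of open normal subgroups of $G$ with $\bigcap_i H_i=\{1\}$ (the limit does not depend on the chain). A group $G$ satisfies a nontrivial group law if there are $k\ge 1$ and a nontrivial element $w(x_1,\dots,x_k)$ of the free group on $x_1,\dots,x_k$ such that $w(g_1,\dots,g_k)=1$ for all $g_1,\dots,g_k\in G$. *)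

theory Defs
  imports
    "HOL-Analysis.Analysis"
    "HOL-Algebra.Coset"
    "HOL-Algebra.Generated_Groups"
begin

locale topological_group = group G
  for G :: "('a, 'b) monoid_scheme" (structure) +
  fixes T :: "'a topology"
  assumes topspace_eq_carrier: "topspace T = carrier G"
    and continuous_mult: "continuous_map (prod_topology T T) T (\<lambda>(x, y). x \<otimes> y)"
    and continuous_inv: "continuous_map T T (\<lambda>x. inv x)"

locale profinite_group = topological_group +
  assumes compact: "compact_space T"
    and hausdorff: "Hausdorff_space T"
    and totally_disconnected:
      "\<And>x. x \<in> topspace T \<Longrightarrow> connected_component_of_set T x = {x}"

definition top_generates ::
    "('a, 'b) monoid_scheme \<Rightarrow> 'a topology \<Rightarrow> 'a set \<Rightarrow> bool" where
  "top_generates G T S \<longleftrightarrow>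
     S \<subseteq> carrier G \<and> T closure_of (generate G S) = carrier G"

definition top_finitely_generated ::
    "('a, 'b) monoid_scheme \<Rightarrow> 'a topology \<Rightarrow> bool" where
  "top_finitely_generated G T \<longleftrightarrow> (\<exists>S. finite S \<and> top_generates G T S)"

text \<open>The infimum is attained when a finite generating set exists, and is \<open>\<infinity>\<close> otherwise.\<close>

definition top_rank ::
    "('a, 'b) monoid_scheme \<Rightarrow> 'a topology \<Rightarrow> enat" where
  "top_rank G T = (INF S \<in> {S. finite S \<and> top_generates G T S}. enat (card S))"

text \<open>
  An open subgroup \<open>H\<close> is regarded as a topological group in its own right, with the
  subspace topology. It has finite index when \<open>G\<close> is compact, so \<open>card (rcosets H)\<close> is then
  a positive number. The values are extended reals and may be negative: the trivial
  subgroup of a finite group \<open>G\<close> contributes \<open>-1 / order G\<close>.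
\<close>

definition rank_gradient ::
    "('a, 'b) monoid_scheme \<Rightarrow> 'a topology \<Rightarrow> ereal" where
  "rank_gradient G T =
     (INF H \<in> {H. subgroup H G \<and> openin T H}.
        (ereal_of_enat (top_rank (G\<lparr>carrier := H\<rparr>) (subtopology T H)) - 1)
          / ereal (real (card (rcosets\<^bsub>G\<^esub> H))))"

text \<open>
  The free group on \<open>k\<close> generators, realised as the reduced words in the letters \<open>(i, True)\<close>
  for the generator \<open>x\<^sub>i\<close> and \<open>(i, False)\<close> for its inverse, where \<open>i < k\<close>.
\<close>

type_synonym letter = "nat \<times> bool"

definition inv_letter :: "letter \<Rightarrow> letter" where
  "inv_letter = (\<lambda>(i, b). (i, \<not> b))"

fun reduced :: "letter list \<Rightarrow> bool" where
  "reduced [] \<longleftrightarrow> True"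
| "reduced [x] \<longleftrightarrow> True"
| "reduced (x # y # w) \<longleftrightarrow> y \<noteq> inv_letter x \<and> reduced (y # w)"

fun cons_red :: "letter \<Rightarrow> letter list \<Rightarrow> letter list" where
  "cons_red x [] = [x]"
| "cons_red x (y # w) = (if y = inv_letter x then w else x # y # w)"

definition free_group :: "nat \<Rightarrow> letter list monoid" where
  "free_group k =
     \<lparr>carrier = {w. reduced w \<and> set w \<subseteq> {..<k} \<times> UNIV},
      monoid.mult = (\<lambda>u v. foldr cons_red u v),
      one = []\<rparr>"

definition eval_letter ::
    "('a, 'b) monoid_scheme \<Rightarrow> (nat \<Rightarrow> 'a) \<Rightarrow> letter \<Rightarrow> 'a" where
  "eval_letter G g = (\<lambda>(i, b). if b then g i else inv\<^bsub>G\<^esub> (g i))"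

definition eval_word ::
    "('a, 'b) monoid_scheme \<Rightarrow> (nat \<Rightarrow> 'a) \<Rightarrow> letter list \<Rightarrow> 'a" where
  "eval_word G g w = foldr (\<lambda>x a. eval_letter G g x \<otimes>\<^bsub>G\<^esub> a) w \<one>\<^bsub>G\<^esub>"

definition satisfies_nontrivial_law :: "('a, 'b) monoid_scheme \<Rightarrow> bool" where
  "satisfies_nontrivial_law G \<longleftrightarrow>
     (\<exists>k\<ge>1. \<exists>w \<in> carrier (free_group k). w \<noteq> \<one>\<^bsub>free_group k\<^esub> \<and>
        (\<forall>g \<in> {..<k} \<rightarrow> carrier G. eval_word G g w = \<one>\<^bsub>G\<^esub>))"

lemma inv_letter_inv_letter [simp]: "inv_letter (inv_letter x) = x"
  by (cases x) (simp add: inv_letter_def)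

lemma inv_letter_neq [simp]: "inv_letter x \<noteq> x" "x \<noteq> inv_letter x"
  by (cases x; simp add: inv_letter_def)+

lemma reduced_tl: "reduced (x # w) \<Longrightarrow> reduced w"
  by (cases w) auto

lemma reduced_cons_red: "reduced w \<Longrightarrow> reduced (cons_red x w)"
  by (cases w) (auto dest: reduced_tl)

lemma reduced_foldr_cons_red: "reduced v \<Longrightarrow> reduced (foldr cons_red u v)"
  by (induction u) (auto intro: reduced_cons_red)

lemma set_cons_red: "set (cons_red x w) \<subseteq> insert x (set w)"
  by (cases w) auto

lemma set_foldr_cons_red: "set (foldr cons_red u v) \<subseteq> set u \<union> set v"
proof (induction u)
  case (Cons x u)
  then show ?case using set_cons_red[of x "foldr cons_red u v"] by auto
qed simp

lemma cons_red_cancel: "reduced w \<Longrightarrow> cons_red x (cons_red (inv_letter x) w) = w"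
proof (cases w)
  case (Cons y w')
  assume "reduced w"
  with Cons show ?thesis by (cases w') auto
qed simp

lemma foldr_cons_red_cons_red:
  assumes "reduced w"
  shows "foldr cons_red (cons_red x u) w = cons_red x (foldr cons_red u w)"
proof (cases u)
  case (Cons y u')
  then show ?thesis
    using cons_red_cancel[OF reduced_foldr_cons_red[OF assms], of x u'] by auto
qed simp

lemma foldr_cons_red_assoc:
  "reduced w \<Longrightarrow>
    foldr cons_red (foldr cons_red u v) w = foldr cons_red u (foldr cons_red v w)"
  by (induction u) (auto simp: foldr_cons_red_cons_red)

lemma foldr_cons_red_Nil: "reduced w \<Longrightarrow> foldr cons_red w [] = w"
proof (induction w)
  case (Cons x w)
  then show ?case by (cases w) auto
qed simp

lemma foldr_cons_red_inverse:
  "reduced v \<Longrightarrow> foldr cons_red (rev (map inv_letter w)) (foldr cons_red w v) = v"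
proof (induction w arbitrary: v)
  case (Cons x w)
  then show ?case
    using cons_red_cancel[OF reduced_foldr_cons_red[OF Cons.prems], of "inv_letter x" w]
    by simp
qed simp

lemma group_free_group: "group (free_group k)"
proof (rule groupI)
  fix w assume w: "w \<in> carrier (free_group k)"
  let ?v = "foldr cons_red (rev (map inv_letter w)) []"
  have "set ?v \<subseteq> {..<k} \<times> UNIV"
    using w set_foldr_cons_red[of "rev (map inv_letter w)" "[]"]
    by (fastforce simp: free_group_def inv_letter_def)
  then have "?v \<in> carrier (free_group k)"
    by (simp add: free_group_def reduced_foldr_cons_red)
  moreover have "foldr cons_red ?v w = []"
    using w foldr_cons_red_inverse[of "[]" w]
    by (simp add: free_group_def foldr_cons_red_assoc foldr_cons_red_Nil)
  ultimately show "\<exists>v\<in>carrier (free_group k). v \<otimes>\<^bsub>free_group k\<^esub> w = \<one>\<^bsub>free_group k\<^esub>"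
    by (auto simp: free_group_def)
next
  fix u v assume "u \<in> carrier (free_group k)" "v \<in> carrier (free_group k)"
  then show "u \<otimes>\<^bsub>free_group k\<^esub> v \<in> carrier (free_group k)"
    using set_foldr_cons_red[of u v] by (auto simp: free_group_def reduced_foldr_cons_red)
qed (auto simp: free_group_def foldr_cons_red_assoc)

lemma (in group) eval_word_hom:
  assumes g: "g \<in> {..<k} \<rightarrow> carrier G"
  shows "eval_word G g \<in> hom (free_group k) G"
proof -
  define W where "W = {..<k} \<times> (UNIV :: bool set)"
  have letter: "eval_letter G g x \<in> carrier G" if "x \<in> W" for x
    using that g by (auto simp: W_def eval_letter_def split: prod.splits)
  have closed: "eval_word G g w \<in> carrier G" if "set w \<subseteq> W" for w
    using that by (induction w) (auto simp: eval_word_def letter)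
  have inv_l: "eval_letter G g (inv_letter x) = inv (eval_letter G g x)" if "x \<in> W" for x
    using that g by (auto simp: inv_inv Pi_iff W_def eval_letter_def inv_letter_def split: prod.splits)
  have cons: "eval_word G g (cons_red x w) = eval_letter G g x \<otimes> eval_word G g w"
    if "x \<in> W" "set w \<subseteq> W" for x w
  proof (cases w)
    case (Cons y w')
    then have "set w' \<subseteq> W" using that by auto
    with Cons that letter[of x] closed[of w'] show ?thesis
      by (auto simp: eval_word_def inv_l m_assoc[symmetric])
  qed (use that in \<open>auto simp: eval_word_def\<close>)
  have "eval_word G g (foldr cons_red u v) = eval_word G g u \<otimes> eval_word G g v"
    if "set u \<subseteq> W" "set v \<subseteq> W" for u v
    using that
  proof (induction u)
    case Nil
    then show ?case using closed[of v] by (simp add: eval_word_def)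
  next
    case (Cons x u)
    have "set (foldr cons_red u v) \<subseteq> W"
      using Cons.prems set_foldr_cons_red[of u v] by auto
    moreover have "eval_word G g (x # u) = eval_letter G g x \<otimes> eval_word G g u"
      by (simp add: eval_word_def)
    ultimately show ?case
      using Cons closed[of u] closed[of v] letter[of x] cons by (simp add: m_assoc)
  qed
  with closed show ?thesis
    by (auto simp: hom_def free_group_def W_def)
qed

end

theory Submission
  imports Defs "HOL-Algebra.Zassenhaus"
begin

text \<open>
  Suppose that \<open>G\<close> satisfies a law in \<open>k\<close> variables and has positive rank gradient. Let \<open>d(H)\<close> be the
  topological rank of an open subgroup \<open>H\<close>. The ratios \<open>d(H) / |G : H|\<close> are bounded away from \<open>0\<close>, and
  by Schreier's bound they do not increase when \<open>H\<close> shrinks. So below a suitable open subgroup they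
  are almost constant: there, passing from \<open>H\<close> to \<open>K\<close> multiplies the rank by nearly \<open>|H : K|\<close>, as in
  a free group, and \<open>d(H)\<close> is as large as desired. The plan is to contradict this by exhibiting many
  redundant Schreier generators of \<open>K\<close>.

  A relation \<open>w\<close> between generators of \<open>H\<close> traces a closed path at every vertex of the Schreier graph
  of \<open>K\<close> in \<open>H\<close>. If the path is simple, then one of its edges can be removed from the generators of \<open>K\<close>
  (\<open>schreier_redundant\<close>), and this can be done for a proportion of at least \<open>1 / (2 * length w)\<close> of all
  vertices at the same time (\<open>independent_cosets\<close>). A path fails to be simple only if a proper subword
  of \<open>w\<close> fixes a vertex, and this is avoided by a minimality argument. Call \<open>w\<close> a coset law if it
  vanishes on some product of \<open>k\<close> cosets of an open normal subgroup, and let \<open>w\<close> be a shortest coset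
  law. Since no shorter word is a coset law, there are a tuple \<open>x\<close> in that product and an open normal
  subgroup \<open>K\<close> such that no shorter word takes a value in \<open>K\<close> at \<open>x\<close> (\<open>tuple_avoiding_words\<close>).

  Let \<open>H\<close> be the subgroup generated by \<open>K\<close> and \<open>x\<close>. Modulo \<open>K\<close>, every generator of \<open>H\<close> is a word
  in \<open>x\<close>, so a generating set of size \<open>d(H)\<close> can be replaced by about \<open>d(H) / k\<close> blocks of \<open>k\<close>
  generators each, all congruent to \<open>x\<close> modulo \<open>K\<close> (\<open>top_gen_blocks\<close>). Every block satisfies the relation
  \<open>w\<close> with simple paths. Altogether about \<open>d(H) |H : K| / (2 k length w)\<close> of the \<open>d(H) |H : K|\<close>
  Schreier generators are redundant (\<open>generators_saved_by_coset_law\<close>), a fixed proportion, while the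
  choice of the initial open subgroup allows only an arbitrarily small one.
\<close>

section \<open>Words and their values\<close>

lemma reduced_append: "reduced (u @ v) \<Longrightarrow> reduced u \<and> reduced v"
  by (induction u rule: reduced.induct) (auto dest: reduced_tl)

lemma eval_word_Nil [simp]: "eval_word G g [] = \<one>\<^bsub>G\<^esub>"
  by (simp add: eval_word_def)

lemma eval_word_Cons [simp]:
  "eval_word G g (x # w) = eval_letter G g x \<otimes>\<^bsub>G\<^esub> eval_word G g w"
  by (simp add: eval_word_def)

context group
begin

lemma eval_letter_closed:
  assumes "g \<in> {..<k} \<rightarrow> carrier G" "x \<in> {..<k} \<times> UNIV"
  shows "eval_letter G g x \<in> carrier G"
  using assms by (auto simp: eval_letter_def Pi_iff)

lemma eval_letter_inv_letter:
  assumes "g \<in> {..<k} \<rightarrow> carrier G" "x \<in> {..<k} \<times> UNIV"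
  shows "eval_letter G g (inv_letter x) = inv (eval_letter G g x)"
  using assms by (auto simp: eval_letter_def inv_letter_def Pi_iff)

lemma eval_word_closed:
  assumes "g \<in> {..<k} \<rightarrow> carrier G" "set w \<subseteq> {..<k} \<times> UNIV"
  shows "eval_word G g w \<in> carrier G"
  using assms(2) by (induction w) (auto simp: eval_letter_closed[OF assms(1)])

lemma eval_word_append:
  assumes "g \<in> {..<k} \<rightarrow> carrier G" "set u \<subseteq> {..<k} \<times> UNIV" "set v \<subseteq> {..<k} \<times> UNIV"
  shows "eval_word G g (u @ v) = eval_word G g u \<otimes> eval_word G g v"
  using assms(2)
proof (induction u)
  case (Cons x u)
  then have "eval_letter G g x \<in> carrier G" "eval_word G g u \<in> carrier G"
    "eval_word G g v \<in> carrier G"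
    using assms by (auto intro!: eval_letter_closed[of g k] eval_word_closed[of g k])
  with Cons show ?case by (auto simp: m_assoc)
qed (use eval_word_closed[OF assms(1,3)] in simp)

end

lemma (in normal) rcos_eval_word_cong:
  assumes g: "g \<in> {..<k} \<rightarrow> carrier G" and g': "g' \<in> {..<k} \<rightarrow> carrier G"
    and eq: "\<And>i. i < k \<Longrightarrow> H #> g i = H #> g' i"
    and w: "set w \<subseteq> {..<k} \<times> UNIV"
  shows "H #> eval_word G g w = H #> eval_word G g' w"
  using w
proof (induction w)
  case (Cons x w)
  obtain i b where x: "x = (i, b)" by (cases x)
  with Cons.prems have i: "i < k" by auto
  have "H #> eval_letter G g x = H #> eval_letter G g' x"
  proof (cases b)
    case False
    have "g i \<in> carrier G" "g' i \<in> carrier G" using g g' i by auto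
    then have "H #> inv (g i) = H #> inv (g' i)"
      using rcos_inv[of "g i"] rcos_inv[of "g' i"] eq[OF i] by simp
    then show ?thesis using False x by (simp add: eval_letter_def)
  qed (use x eq i in \<open>simp add: eval_letter_def\<close>)
  moreover have "H #> eval_word G f (x # w) = (H #> eval_letter G f x) <#> (H #> eval_word G f w)"
    if "f \<in> {..<k} \<rightarrow> carrier G" for f
    using eval_letter_closed[OF that, of x] eval_word_closed[OF that, of w] Cons.prems
    by (simp add: rcos_sum)
  ultimately show ?case using Cons g g' by simp
qed simp

section \<open>Large independent sets in digraphs of small degree\<close>

text \<open>
  Join \<open>v\<close> to each \<open>f i v\<close>. Injectivity bounds the in-degree as well as the out-degree by the
  number of maps, so an inclusion-maximal independent set \<open>R\<close>, its images and its preimages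
  together cover \<open>V\<close>.
\<close>

lemma independent_set_of_injections:
  fixes f :: "'i \<Rightarrow> 'v \<Rightarrow> 'v"
  assumes fin: "finite V" "finite I"
    and inj: "\<And>i. i \<in> I \<Longrightarrow> inj_on (f i) V"
    and no_fix: "\<And>i v. i \<in> I \<Longrightarrow> v \<in> V \<Longrightarrow> f i v \<noteq> v"
  obtains R where "R \<subseteq> V" "\<And>i v. i \<in> I \<Longrightarrow> v \<in> R \<Longrightarrow> f i v \<notin> R"
    "card V \<le> (1 + 2 * card I) * card R"
proof -
  define indep where "indep R \<longleftrightarrow> R \<subseteq> V \<and> (\<forall>i\<in>I. \<forall>v\<in>R. f i v \<notin> R)" for R
  have "finite {R. indep R}"
    by (rule finite_subset[of _ "Pow V"]) (auto simp: indep_def fin)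
  moreover have "indep {}" by (simp add: indep_def)
  ultimately obtain R where R: "indep R" and max: "\<And>S. indep S \<Longrightarrow> R \<subseteq> S \<Longrightarrow> R = S"
    using finite_has_maximal[of "{R. indep R}"] by (metis empty_iff mem_Collect_eq)
  have RV: "R \<subseteq> V" and finR: "finite R"
    using R finite_subset fin by (auto simp: indep_def)
  have cover: "V \<subseteq> R \<union> (\<Union>i\<in>I. f i ` R \<union> (f i -` R \<inter> V))"
  proof
    fix v assume v: "v \<in> V"
    show "v \<in> R \<union> (\<Union>i\<in>I. f i ` R \<union> (f i -` R \<inter> V))"
    proof (rule ccontr)
      assume no: "v \<notin> R \<union> (\<Union>i\<in>I. f i ` R \<union> (f i -` R \<inter> V))"
      have "f i a \<notin> insert v R" if i: "i \<in> I" and a: "a \<in> insert v R" for i a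
      proof (cases "a = v")
        case True
        then show ?thesis using no no_fix[OF i v] i v by auto
      next
        case False
        then have "a \<in> R" "f i a \<notin> R" using a R i by (auto simp: indep_def)
        moreover have "f i a \<noteq> v" using no i \<open>a \<in> R\<close> by blast
        ultimately show ?thesis by simp
      qed
      then have "indep (insert v R)"
        using RV v by (auto simp: indep_def)
      with max[of "insert v R"] no show False by blast
    qed
  qed
  have "card V \<le> card (R \<union> (\<Union>i\<in>I. f i ` R \<union> (f i -` R \<inter> V)))"
    using fin finR by (intro card_mono[OF _ cover]) auto
  also have "\<dots> \<le> card R + card (\<Union>i\<in>I. f i ` R \<union> (f i -` R \<inter> V))"
    by (rule card_Un_le)
  also have "card (\<Union>i\<in>I. f i ` R \<union> (f i -` R \<inter> V)) \<le> (\<Sum>i\<in>I. card (f i ` R \<union> (f i -` R \<inter> V)))"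
    by (rule card_UN_le[OF fin(2)])
  also have "\<dots> \<le> (\<Sum>i\<in>I. 2 * card R)"
  proof (rule sum_mono)
    fix i assume i: "i \<in> I"
    have "card (f i -` R \<inter> V) \<le> card R"
      using inj[OF i] by (intro card_inj_on_le[of "f i"] finR) (auto simp: inj_on_def)
    then show "card (f i ` R \<union> (f i -` R \<inter> V)) \<le> 2 * card R"
      using card_Un_le[of "f i ` R" "f i -` R \<inter> V"] card_image_le[OF finR, of "f i"] by linarith
  qed
  finally have "card V \<le> (1 + 2 * card I) * card R"
    by (simp add: algebra_simps)
  with R show ?thesis by (intro that[of R]) (auto simp: indep_def)
qed

section \<open>Coset representatives and the Schreier cocycle\<close>

text \<open>
  Representing \<open>K\<close> itself by the identity is what makes \<open>schreier G K \<one> x = x\<close> for \<open>x \<in> K\<close>.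
\<close>

definition coset_rep :: "('a, 'b) monoid_scheme \<Rightarrow> 'a set \<Rightarrow> 'a \<Rightarrow> 'a" where
  "coset_rep G K g =
     (if K #>\<^bsub>G\<^esub> g = K then \<one>\<^bsub>G\<^esub> else SOME h. h \<in> K #>\<^bsub>G\<^esub> g)"

text \<open>
  The element of \<open>K\<close> read off along the edge labelled \<open>x\<close> that starts at the coset of \<open>g\<close> in
  the Schreier graph of \<open>K\<close>. Allowing every group element as a label turns Schreier generators into
  a cocycle, so that relations between labels become relations between Schreier generators.
\<close>

definition schreier :: "('a, 'b) monoid_scheme \<Rightarrow> 'a set \<Rightarrow> 'a \<Rightarrow> 'a \<Rightarrow> 'a" where
  "schreier G K g x =
     coset_rep G K g \<otimes>\<^bsub>G\<^esub> x \<otimes>\<^bsub>G\<^esub> inv\<^bsub>G\<^esub> coset_rep G K (g \<otimes>\<^bsub>G\<^esub> x)"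

context group
begin

lemma coset_rep_cong: "K #> g = K #> g' \<Longrightarrow> coset_rep G K g = coset_rep G K g'"
  by (simp add: coset_rep_def)

lemma rcos_mult_cong:
  assumes "subgroup K G" "g \<in> carrier G" "g' \<in> carrier G" "x \<in> carrier G"
    "K #> g = K #> g'"
  shows "K #> (g \<otimes> x) = K #> (g' \<otimes> x)"
  using assms by (metis coset_mult_assoc subgroup.subset)

lemma rcos_mult_cancel:
  assumes "subgroup K G" "g \<in> carrier G" "g' \<in> carrier G" "x \<in> carrier G"
    "K #> (g \<otimes> x) = K #> (g' \<otimes> x)"
  shows "K #> g = K #> g'"
  using rcos_mult_cong[OF assms(1) _ _ _ assms(5), of "inv x"] assms(2-4)
  by (simp add: m_assoc)

lemma coset_rep_in:
  assumes "subgroup K G" "g \<in> carrier G"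
  shows "coset_rep G K g \<in> K #> g"
proof (cases "K #> g = K")
  case True
  then show ?thesis using subgroup.one_closed[OF assms(1)] by (simp add: coset_rep_def)
next
  case False
  then show ?thesis
    using rcos_self[OF assms(2,1)] someI[of "\<lambda>h. h \<in> K #> g"] by (simp add: coset_rep_def)
qed

lemma coset_rep_closed [simp]:
  assumes "subgroup K G" "g \<in> carrier G"
  shows "coset_rep G K g \<in> carrier G"
  using coset_rep_in[OF assms] r_coset_subset_G[of K g] assms subgroup.subset by blast

lemma rcos_coset_rep [simp]:
  assumes "subgroup K G" "g \<in> carrier G"
  shows "K #> coset_rep G K g = K #> g"
  using repr_independence[OF coset_rep_in[OF assms] assms(2,1)] by simp

lemma coset_rep_eq_iff:
  assumes "subgroup K G" "g \<in> carrier G" "g' \<in> carrier G"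
  shows "coset_rep G K g = coset_rep G K g' \<longleftrightarrow> K #> g = K #> g'"
  using assms coset_rep_cong rcos_coset_rep by metis

lemma coset_rep_mem:
  assumes "subgroup K G" "g \<in> K"
  shows "coset_rep G K g = \<one>"
  using coset_join2[OF _ assms] subgroup.mem_carrier[OF assms] by (simp add: coset_rep_def)

lemma schreier_closed:
  assumes "subgroup K G" "g \<in> carrier G" "x \<in> carrier G"
  shows "schreier G K g x \<in> K"
proof -
  have "coset_rep G K g \<otimes> x \<in> K #> coset_rep G K (g \<otimes> x)"
    using rcos_mult_cong[OF assms(1) _ assms(2,3), of "coset_rep G K g"] assms
      rcos_self[of "coset_rep G K g \<otimes> x" K] by simp
  then show ?thesis
    using subgroup.rcos_module_imp[OF assms(1) is_group, of "coset_rep G K (g \<otimes> x)"] assms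
    by (simp add: schreier_def)
qed

lemma schreier_in_carrier:
  assumes "subgroup K G" "g \<in> carrier G" "x \<in> carrier G"
  shows "schreier G K g x \<in> carrier G"
  using schreier_closed[OF assms] subgroup.mem_carrier[OF assms(1)] by blast

lemma schreier_mult:
  assumes "subgroup K G" "g \<in> carrier G" "x \<in> carrier G" "y \<in> carrier G"
  shows "schreier G K g (x \<otimes> y) = schreier G K g x \<otimes> schreier G K (g \<otimes> x) y"
proof -
  let ?a = "coset_rep G K g" and ?b = "coset_rep G K (g \<otimes> x)"
    and ?c = "coset_rep G K (g \<otimes> x \<otimes> y)"
  have cl: "?a \<in> carrier G" "?b \<in> carrier G" "?c \<in> carrier G" using assms by simp_all
  have "(?a \<otimes> x \<otimes> inv ?b) \<otimes> (?b \<otimes> y \<otimes> inv ?c) = ?a \<otimes> x \<otimes> (inv ?b \<otimes> ?b) \<otimes> y \<otimes> inv ?c"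
    using cl assms(3,4) by (simp only: m_assoc m_closed inv_closed)
  also have "\<dots> = ?a \<otimes> (x \<otimes> y) \<otimes> inv ?c"
    using cl assms(3,4) by (simp add: m_assoc)
  finally show ?thesis using assms by (simp add: schreier_def m_assoc)
qed

lemma schreier_one:
  assumes "subgroup K G" "g \<in> carrier G"
  shows "schreier G K g \<one> = \<one>"
  using assms by (simp add: schreier_def)

lemma schreier_inv:
  assumes "subgroup K G" "g \<in> carrier G" "x \<in> carrier G"
  shows "schreier G K g (inv x) = inv (schreier G K (g \<otimes> inv x) x)"
proof -
  have "schreier G K g (inv x) \<otimes> schreier G K (g \<otimes> inv x) x = \<one>"
    using schreier_mult[OF assms(1,2) inv_closed[OF assms(3)] assms(3)] assms
    by (simp add: schreier_one)
  then show ?thesis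
    using inv_equality[of "schreier G K g (inv x)" "schreier G K (g \<otimes> inv x) x"] assms
    by (simp add: schreier_in_carrier)
qed

lemma schreier_coset_rep:
  assumes "subgroup K G" "g \<in> carrier G" "x \<in> carrier G"
  shows "schreier G K (coset_rep G K g) x = schreier G K g x"
  unfolding schreier_def
  using coset_rep_cong[OF rcos_coset_rep[OF assms(1,2)]]
    coset_rep_cong[OF rcos_mult_cong[OF assms(1) _ assms(2,3) rcos_coset_rep[OF assms(1,2)]]] assms
  by simp

lemma schreier_mem:
  assumes "subgroup K G" "x \<in> K"
  shows "schreier G K \<one> x = x"
  using assms subgroup.mem_carrier[OF assms] subgroup.one_closed[OF assms(1)]
  by (simp add: schreier_def coset_rep_mem)

text \<open>
  By the cocycle identity, the labels all of whose edges carry values in \<open>P\<close> form a subgroup.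
\<close>

lemma schreier_generate:
  assumes K: "subgroup K G" and H: "subgroup H G" and XH: "X \<subseteq> H" and P: "subgroup P G"
    and gen: "\<And>h x. h \<in> H \<Longrightarrow> x \<in> X \<Longrightarrow> schreier G K h x \<in> P"
    and y: "y \<in> generate G X" and h: "h \<in> H"
  shows "schreier G K h y \<in> P"
  using y h
proof (induction arbitrary: h)
  case one
  then show ?case
    using schreier_one[OF K] subgroup.mem_carrier[OF H] subgroup.one_closed[OF P] by simp
next
  case (incl x)
  then show ?case using gen by blast
next
  case (inv x)
  have "x \<in> H" using inv XH by blast
  then have "schreier G K (h \<otimes> inv x) x \<in> P" "x \<in> carrier G" "h \<in> carrier G"
    using gen inv H by (auto simp: subgroup.m_closed subgroup.m_inv_closed subgroup.mem_carrier)
  then show ?case by (simp add: schreier_inv[OF K] subgroup.m_inv_closed[OF P])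
next
  case (eng a b)
  have X: "generate G X \<subseteq> H" using generate_subgroup_incl[OF XH H] .
  then have "a \<in> H" "b \<in> H" using eng by auto
  then have "schreier G K h a \<in> P" "schreier G K (h \<otimes> a) b \<in> P"
    "a \<in> carrier G" "b \<in> carrier G" "h \<in> carrier G"
    using eng H by (auto simp: subgroup.m_closed subgroup.mem_carrier)
  then show ?case by (simp add: schreier_mult[OF K] subgroup.m_closed[OF P])
qed

text \<open>
  Schreier's lemma: an element of \<open>K\<close> labels a loop at the trivial coset, and its value along this
  loop is the element itself. The subgroup \<open>P\<close> is kept arbitrary because it will be generated by
  only some of the Schreier generators.
\<close>

lemma generate_Int_subset_of_schreier:
  assumes "subgroup K G" "subgroup H G" "X \<subseteq> H" "subgroup P G"
    and "\<And>h x. h \<in> H \<Longrightarrow> x \<in> X \<Longrightarrow> schreier G K h x \<in> P"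
  shows "generate G X \<inter> K \<subseteq> P"
  using schreier_generate[OF assms(1-4), of _ \<one>] assms(5) schreier_mem[OF assms(1)]
    subgroup.one_closed[OF assms(2)] by fastforce

lemma bij_betw_coset_reps:
  assumes "subgroup K G" "subgroup H G"
  shows "bij_betw ((#>) K) (coset_rep G K ` H) ((#>) K ` H)"
  unfolding bij_betw_def
proof
  have H: "h \<in> carrier G" if "h \<in> H" for h using that assms subgroup.mem_carrier by metis
  show "inj_on ((#>) K) (coset_rep G K ` H)"
    using H assms by (auto simp: inj_on_def intro: coset_rep_cong)
  have "(#>) K ` coset_rep G K ` H = (\<lambda>h. K #> coset_rep G K h) ` H" by (simp add: image_image)
  also have "\<dots> = (#>) K ` H" using H assms by (intro image_cong) auto
  finally show "(#>) K ` coset_rep G K ` H = (#>) K ` H" .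
qed

text \<open>
  Multiplicativity of the index in a possibly infinite group: right translation by \<open>g\<close> identifies
  the cosets of \<open>K\<close> inside \<open>H\<close> with those inside \<open>H #> g\<close>.
\<close>

lemma card_rcosets_tower:
  assumes K: "subgroup K G" and H: "subgroup H G" and KH: "K \<subseteq> H"
    and fin: "finite (rcosets K)"
  shows "card (rcosets K) = card (rcosets H) * card ((#>) K ` H)"
proof -
  have Kc: "K \<subseteq> carrier G" and Hc: "H \<subseteq> carrier G" using K H subgroup.subset by auto
  have un: "rcosets K = (\<Union>C \<in> rcosets H. (#>) K ` C)" (is "_ = ?U")
  proof
    show "rcosets K \<subseteq> ?U"
      using rcos_self[OF _ H] unfolding RCOSETS_def by fast
    show "?U \<subseteq> rcosets K"
      using subgroup.rcosets_carrier[OF H is_group] rcosetsI[OF Kc] by blast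
  qed
  have "rcosets H = (\<lambda>C. H <#> C) ` (rcosets K)"
  proof -
    have "H #> g = H <#> (K #> g)" if "g \<in> carrier G" for g
    proof -
      have "H <#> (K #> g) = (H <#> K) #> g" using setmult_rcos_assoc[OF Hc Kc that] .
      moreover have "H <#> K = H"
      proof
        show "H <#> K \<subseteq> H"
          using KH subgroup.m_closed[OF H] unfolding set_mult_def by blast
        show "H \<subseteq> H <#> K"
        proof
          fix h assume "h \<in> H"
          then have "h = h \<otimes> \<one>" using Hc by auto
          then show "h \<in> H <#> K"
            using \<open>h \<in> H\<close> subgroup.one_closed[OF K] unfolding set_mult_def by blast
        qed
      qed
      ultimately show ?thesis by simp
    qed
    then show ?thesis unfolding RCOSETS_def by auto
  qed
  then have finH: "finite (rcosets H)" using fin by simp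
  have card_C: "card ((#>) K ` C) = card ((#>) K ` H)" if C: "C \<in> rcosets H" for C
  proof -
    obtain g where g: "g \<in> carrier G" and Ceq: "C = H #> g" using C by (auto simp: RCOSETS_def)
    have "C = (\<lambda>h. h \<otimes> g) ` H" by (auto simp: Ceq r_coset_def)
    then have "(#>) K ` C = (\<lambda>h. K #> (h \<otimes> g)) ` H" by (simp add: image_image)
    also have "\<dots> = (\<lambda>h. K #> h #> g) ` H"
      using g Hc by (intro image_cong) (auto simp: coset_mult_assoc[OF Kc])
    finally have eq: "(#>) K ` C = (\<lambda>D. D #> g) ` ((#>) K ` H)" by (simp add: image_image)
    have "inj_on (\<lambda>D. D #> g) ((#>) K ` H)"
    proof (rule inj_onI, clarify)
      fix h h' assume h: "h \<in> H" "h' \<in> H" and e: "K #> h #> g = K #> h' #> g"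
      then have hc: "h \<in> carrier G" "h' \<in> carrier G" using Hc by auto
      show "K #> h = K #> h'"
        using rcos_mult_cancel[OF K hc g] e hc g by (simp add: coset_mult_assoc[OF Kc])
    qed
    then show ?thesis using eq by (simp add: card_image)
  qed
  have "card (rcosets K) = (\<Sum>C \<in> rcosets H. card ((#>) K ` C))"
    unfolding un
  proof (rule card_UN_disjoint[OF finH])
    show "\<forall>C\<in>rcosets H. finite ((#>) K ` C)"
      using fin un by (metis UN_upper finite_subset)
    have "C = C'" if "C \<in> rcosets H" "C' \<in> rcosets H" "c \<in> C" "c' \<in> C'" "K #> c = K #> c'"
      for C C' c c'
    proof -
      have cc: "c \<in> carrier G" "c' \<in> carrier G"
        using that subgroup.rcosets_carrier[OF H is_group] by blast+
      have "c' \<in> K #> c" using that cc repr_independenceD[OF K] by metis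
      then have "c' \<in> H #> c" using KH by (auto simp: r_coset_def)
      moreover have "H #> c = C"
        using that(1,3) repr_independence[OF _ _ H] by (auto simp: RCOSETS_def)
      ultimately have "c' \<in> C" by simp
      then show ?thesis
        using that rcos_disjoint[OF H] by (auto simp: pairwise_def disjnt_def)
    qed
    then show "\<forall>C\<in>rcosets H. \<forall>C'\<in>rcosets H. C \<noteq> C' \<longrightarrow> (#>) K ` C \<inter> (#>) K ` C' = {}"
      by blast
  qed
  also have "\<dots> = card (rcosets H) * card ((#>) K ` H)"
    using card_C by simp
  finally show ?thesis .
qed

end

section \<open>Open subgroups of profinite groups\<close>

context topological_group
begin

lemma continuous_map_mult:
  assumes "continuous_map X T f" "continuous_map X T g"
  shows "continuous_map X T (\<lambda>x. f x \<otimes> g x)"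
  using continuous_map_compose[OF continuous_map_pairedI[OF assms] continuous_mult]
  by (simp add: o_def)

lemma openin_rcos:
  assumes "openin T H" "g \<in> carrier G"
  shows "openin T (H #> g)"
proof -
  have Hc: "H \<subseteq> carrier G" using openin_subset[OF assms(1)] by (simp add: topspace_eq_carrier)
  have "continuous_map T T (\<lambda>x. x \<otimes> inv g)"
    using assms(2) by (intro continuous_map_mult) (auto simp: topspace_eq_carrier)
  then have "openin T {x \<in> topspace T. x \<otimes> inv g \<in> H}"
    using assms(1) by (rule openin_continuous_map_preimage)
  also have "{x \<in> topspace T. x \<otimes> inv g \<in> H} = H #> g"
  proof
    show "{x \<in> topspace T. x \<otimes> inv g \<in> H} \<subseteq> H #> g"
    proof clarify
      fix x assume x: "x \<in> topspace T" "x \<otimes> inv g \<in> H"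
      then have "x = x \<otimes> inv g \<otimes> g" using assms(2) by (simp add: topspace_eq_carrier m_assoc)
      then show "x \<in> H #> g" using x unfolding r_coset_def by blast
    qed
    show "H #> g \<subseteq> {x \<in> topspace T. x \<otimes> inv g \<in> H}"
      using Hc assms(2) by (auto simp: r_coset_def topspace_eq_carrier m_assoc subset_iff)
  qed
  finally show ?thesis .
qed

lemma closedin_open_subgroup:
  assumes "subgroup H G" "openin T H"
  shows "closedin T H"
proof -
  have "carrier G - H = (\<Union>g \<in> carrier G - H. H #> g)"
  proof
    show "carrier G - H \<subseteq> (\<Union>g \<in> carrier G - H. H #> g)"
      using rcos_self[OF _ assms(1)] by blast
    show "(\<Union>g \<in> carrier G - H. H #> g) \<subseteq> carrier G - H"
    proof
      fix x assume "x \<in> (\<Union>g \<in> carrier G - H. H #> g)"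
      then obtain g where g: "g \<in> carrier G" "g \<notin> H" and x: "x \<in> H #> g" by blast
      obtain h where h: "h \<in> H" "x = h \<otimes> g" using x by (auto simp: r_coset_def)
      have hc: "h \<in> carrier G" using h assms subgroup.mem_carrier by metis
      have "g \<in> H" if "x \<in> H"
      proof -
        have "g = inv h \<otimes> x" using h hc g by (simp add: m_assoc[symmetric])
        then show ?thesis
          using that subgroup.m_closed[OF assms(1) subgroup.m_inv_closed[OF assms(1) h(1)]] by metis
      qed
      with g h hc show "x \<in> carrier G - H" by auto
    qed
  qed
  moreover have "openin T (\<Union>g \<in> carrier G - H. H #> g)"
    using openin_rcos[OF assms(2)] by auto
  ultimately show ?thesis
    using subgroup.subset[OF assms(1)] by (simp add: closedin_def topspace_eq_carrier)
qed

lemma openin_overgroup: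
  assumes "subgroup H G" "openin T K" "\<one> \<in> K" "K \<subseteq> H"
  shows "openin T H"
proof -
  have Hc: "h \<in> carrier G" if "h \<in> H" for h using that subgroup.mem_carrier[OF assms(1)] by blast
  have "H = (\<Union>h\<in>H. K #> h)"
  proof
    show "H \<subseteq> (\<Union>h\<in>H. K #> h)" using Hc assms(3) l_one unfolding r_coset_def by force
    show "(\<Union>h\<in>H. K #> h) \<subseteq> H"
      using subgroup.m_closed[OF assms(1)] assms(4) by (auto simp: r_coset_def)
  qed
  moreover have "openin T (\<Union>h\<in>H. K #> h)"
    using openin_rcos[OF assms(2)] Hc by blast
  ultimately show ?thesis by simp
qed

text \<open>
  Topological generation of \<open>H\<close> expressed in the ambient group; for subgroups \<open>H\<close> it agrees with
  generation inside \<open>H\<close> with the subspace topology.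
\<close>

definition top_gen :: "'a set \<Rightarrow> 'a set \<Rightarrow> bool" where
  "top_gen H S \<longleftrightarrow> finite S \<and> S \<subseteq> H \<and> H \<subseteq> T closure_of (generate G S)"

lemma top_gen_iff:
  assumes "subgroup H G"
  shows "finite S \<and> top_generates (G\<lparr>carrier := H\<rparr>) (subtopology T H) S \<longleftrightarrow> top_gen H S"
proof -
  have "subtopology T H closure_of generate (G\<lparr>carrier := H\<rparr>) S = H \<inter> T closure_of generate G S"
    if "S \<subseteq> H"
  proof -
    have "H \<inter> generate G S = generate G S"
      using generate_subgroup_incl[OF that assms] by blast
    then show ?thesis
      by (simp add: generate_consistent[OF that assms] closure_of_subtopology)
  qed
  then show ?thesis by (auto simp: top_generates_def top_gen_def)
qed

text \<open>
  Meaningful for topologically finitely generated \<open>H\<close>; an infinite rank is mapped to the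
  unspecified natural number \<open>the_enat \<infinity>\<close>.
\<close>

definition subgroup_rank :: "'a set \<Rightarrow> nat" where
  "subgroup_rank H = the_enat (top_rank (G\<lparr>carrier := H\<rparr>) (subtopology T H))"

lemma top_rank_attained:
  assumes "subgroup H G" "top_gen H S0"
  obtains S where "top_gen H S" "card S = subgroup_rank H"
    "top_rank (G\<lparr>carrier := H\<rparr>) (subtopology T H) = enat (subgroup_rank H)"
proof -
  let ?A = "(\<lambda>S. enat (card S)) ` {S. top_gen H S}"
  have eq: "top_rank (G\<lparr>carrier := H\<rparr>) (subtopology T H) = Inf ?A"
    by (simp add: top_rank_def top_gen_iff[OF assms(1)])
  have "Inf ?A \<in> ?A" using assms(2) by (intro wellorder_InfI) blast
  then obtain S where "top_gen H S" "Inf ?A = enat (card S)" by auto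
  then show ?thesis using that by (simp add: eq subgroup_rank_def)
qed

lemma subgroup_rank_le:
  assumes "subgroup H G" "top_gen H S"
  shows "subgroup_rank H \<le> card S"
proof -
  have "top_rank (G\<lparr>carrier := H\<rparr>) (subtopology T H) \<le> enat (card S)"
    unfolding top_rank_def top_gen_iff[OF assms(1)] using assms(2) by (intro INF_lower) simp
  then show ?thesis
    using top_rank_attained[OF assms] by (metis enat_ord_simps(1))
qed

text \<open>
  Schreier's lemma gives \<open>K \<inter> generate G X\<close> only, but since \<open>K\<close> is open and \<open>generate G X\<close> is dense
  in \<open>H\<close>, that intersection is dense in \<open>K\<close>.
\<close>

lemma top_gen_of_schreier:
  assumes K: "subgroup K G" "openin T K" and H: "subgroup H G" "K \<subseteq> H"
    and X: "top_gen H X"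
    and S: "finite S" "S \<subseteq> K"
    and gen: "\<And>h x. h \<in> H \<Longrightarrow> x \<in> X \<Longrightarrow> schreier G K h x \<in> generate G S"
  shows "top_gen K S"
proof -
  have "X \<subseteq> H" using X by (simp add: top_gen_def)
  have "subgroup (generate G S) G"
    using S subgroup.subset[OF K(1)] by (intro generate_is_subgroup) auto
  from generate_Int_subset_of_schreier[OF K(1) H(1) \<open>X \<subseteq> H\<close> this gen]
  have sub: "K \<inter> generate G X \<subseteq> generate G S" by blast
  have "K \<subseteq> K \<inter> T closure_of generate G X" using X H(2) by (auto simp: top_gen_def)
  also have "\<dots> \<subseteq> T closure_of (K \<inter> generate G X)"
    by (rule openin_Int_closure_of_subset[OF K(2)])
  also have "\<dots> \<subseteq> T closure_of generate G S"
    by (rule closure_of_mono[OF sub])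
  finally show ?thesis using S by (simp add: top_gen_def)
qed

end

context profinite_group
begin

lemma finite_rcosets_open_subgroup:
  assumes "subgroup H G" "openin T H"
  shows "finite (rcosets H)"
proof -
  have "compactin T (carrier G)" using compact by (simp add: compact_space_def topspace_eq_carrier)
  moreover have "openin T C" if "C \<in> rcosets H" for C
    using that openin_rcos[OF assms(2)] by (auto simp: RCOSETS_def)
  ultimately obtain F where F: "finite F" "F \<subseteq> rcosets H" "carrier G \<subseteq> \<Union>F"
    using rcosets_part_G[OF assms(1)] unfolding compactin_def by (metis order_refl)
  have "C \<in> F" if C: "C \<in> rcosets H" for C
  proof -
    obtain g where g: "g \<in> carrier G" "C = H #> g" using C by (auto simp: RCOSETS_def)
    then obtain D where D: "D \<in> F" "g \<in> D" using F(3) by blast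
    moreover have "g \<in> C" using g rcos_self[OF _ assms(1)] by simp
    ultimately have "C = D"
      using rcos_disjoint[OF assms(1)] C F(2) by (auto simp: pairwise_def disjnt_def)
    with D show ?thesis by simp
  qed
  then show ?thesis by (intro finite_subset[OF subsetI F(1)])
qed

lemma card_rcosets_pos:
  assumes "subgroup H G" "openin T H"
  shows "card (rcosets H) > 0"
  using finite_rcosets_open_subgroup[OF assms] rcosetsI[OF subgroup.subset[OF assms(1)] one_closed]
  by (metis card_gt_0_iff empty_iff)

text \<open>
  In a compact Hausdorff space the components coincide with the quasi-components, so total
  disconnectedness provides clopen sets.
\<close>

lemma clopen_separation:
  assumes "x \<in> carrier G" "x \<noteq> \<one>"
  obtains U where "openin T U" "closedin T U" "\<one> \<in> U" "x \<notin> U"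
proof -
  have "quasi_component_of T \<one> = connected_component_of T \<one>"
    by (rule quasi_eq_connected_component_of) (use compact hausdorff in blast)
  moreover have "\<not> connected_component_of T \<one> x"
    using totally_disconnected[of \<one>] assms by (auto simp: topspace_eq_carrier)
  ultimately have "\<not> quasi_component_of T \<one> x" by simp
  then obtain U where U: "closedin T U" "openin T U" "(\<one> \<in> U) \<noteq> (x \<in> U)"
    using assms by (auto simp: quasi_component_of_def topspace_eq_carrier)
  show ?thesis
  proof (cases "\<one> \<in> U")
    case True
    then show ?thesis using U that by blast
  next
    case False
    then have "\<one> \<in> topspace T - U" "x \<notin> topspace T - U"
      using U by (auto simp: topspace_eq_carrier)
    then show ?thesis using U(1,2) that by blast
  qed
qed

text \<open>
  The elements that may be inserted into any product of two factors without affecting membership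
  in \<open>U\<close> form a normal subgroup (the class of the identity in the syntactic congruence of \<open>U\<close>).
  Its complement is the projection of a closed subset of \<open>(G \<times> G) \<times> G\<close> along the compact factor
  \<open>G \<times> G\<close>, hence is closed.
\<close>

lemma open_normal_subgroup_in_clopen:
  assumes U: "openin T U" "closedin T U" "\<one> \<in> U"
  obtains N where "N \<lhd> G" "openin T N" "N \<subseteq> U"
proof -
  define N where "N = {g \<in> carrier G. \<forall>a\<in>carrier G. \<forall>b\<in>carrier G. a \<otimes> g \<otimes> b \<in> U \<longleftrightarrow> a \<otimes> b \<in> U}"
  have N: "a \<otimes> g \<otimes> b \<in> U \<longleftrightarrow> a \<otimes> b \<in> U" if "g \<in> N" "a \<in> carrier G" "b \<in> carrier G" for g a b
    using that by (auto simp: N_def)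
  have Nc: "g \<in> carrier G" if "g \<in> N" for g using that by (simp add: N_def)
  have NI: "g \<in> N" if "g \<in> carrier G"
    "\<And>a b. a \<in> carrier G \<Longrightarrow> b \<in> carrier G \<Longrightarrow> a \<otimes> g \<otimes> b \<in> U \<longleftrightarrow> a \<otimes> b \<in> U" for g
    using that by (simp add: N_def)
  have sub: "subgroup N G"
  proof (rule subgroupI)
    show "N \<subseteq> carrier G" by (auto simp: N_def)
    have "\<one> \<in> N" by (auto intro!: NI)
    then show "N \<noteq> {}" by blast
  next
    fix g assume g: "g \<in> N"
    show "inv g \<in> N"
    proof (rule NI)
      fix a b assume ab: "a \<in> carrier G" "b \<in> carrier G"
      show "a \<otimes> inv g \<otimes> b \<in> U \<longleftrightarrow> a \<otimes> b \<in> U"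
        using N[OF g, of "a \<otimes> inv g" b] ab Nc[OF g] by (simp add: m_assoc)
    qed (use Nc[OF g] in simp)
  next
    fix g h assume g: "g \<in> N" and h: "h \<in> N"
    show "g \<otimes> h \<in> N"
    proof (rule NI)
      fix a b assume ab: "a \<in> carrier G" "b \<in> carrier G"
      show "a \<otimes> (g \<otimes> h) \<otimes> b \<in> U \<longleftrightarrow> a \<otimes> b \<in> U"
        using N[OF g, of a "h \<otimes> b"] N[OF h, of a b] ab Nc[OF g] Nc[OF h] by (simp add: m_assoc)
    qed (use Nc[OF g] Nc[OF h] in simp)
  qed
  have normal: "N \<lhd> G"
    unfolding normal_inv_iff
  proof (intro conjI ballI sub)
    fix x h assume x: "x \<in> carrier G" and h: "h \<in> N"
    show "x \<otimes> h \<otimes> inv x \<in> N"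
    proof (rule NI)
      fix a b assume ab: "a \<in> carrier G" "b \<in> carrier G"
      have "x \<otimes> (inv x \<otimes> b) = b" using x ab by (simp add: m_assoc[symmetric])
      then show "a \<otimes> (x \<otimes> h \<otimes> inv x) \<otimes> b \<in> U \<longleftrightarrow> a \<otimes> b \<in> U"
        using N[OF h, of "a \<otimes> x" "inv x \<otimes> b"] ab x Nc[OF h] by (simp add: m_assoc)
    qed (use x Nc[OF h] in simp)
  qed
  have "N \<subseteq> U"
    using N[of _ \<one> \<one>] Nc U(3) by fastforce
  have "openin T N"
  proof -
    let ?P = "prod_topology (prod_topology T T) T"
    let ?f = "\<lambda>p. fst (fst p) \<otimes> snd p \<otimes> snd (fst p)" and ?g = "\<lambda>p. fst (fst p) \<otimes> snd (fst p)"
    have p1: "continuous_map ?P T (\<lambda>p. fst (fst p))"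
      using continuous_map_compose[OF continuous_map_fst[of "prod_topology T T" T] continuous_map_fst]
      by (simp add: o_def)
    have p2: "continuous_map ?P T (\<lambda>p. snd (fst p))"
      using continuous_map_compose[OF continuous_map_fst[of "prod_topology T T" T] continuous_map_snd]
      by (simp add: o_def)
    have f: "continuous_map ?P T ?f" and g: "continuous_map ?P T ?g"
      by (intro continuous_map_mult p1 p2 continuous_map_snd)+
    have Uc: "closedin T (topspace T - U)" using U(1) by blast
    \<comment> \<open>the triples \<open>((a, b), x)\<close> for which inserting \<open>x\<close> changes membership in \<open>U\<close>\<close>
    define D where "D = ({p \<in> topspace ?P. ?f p \<in> U} \<inter> {p \<in> topspace ?P. ?g p \<in> topspace T - U}) \<union>
      ({p \<in> topspace ?P. ?f p \<in> topspace T - U} \<inter> {p \<in> topspace ?P. ?g p \<in> U})"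
    have "closedin ?P D"
      unfolding D_def by (intro closedin_Un closedin_Int closedin_continuous_map_preimage[OF f U(2)]
          closedin_continuous_map_preimage[OF f Uc] closedin_continuous_map_preimage[OF g U(2)]
          closedin_continuous_map_preimage[OF g Uc])
    moreover have "compact_space (prod_topology T T)"
      using compact by (simp add: compact_space_prod_topology)
    ultimately have "closedin T (snd ` D)"
      using closed_map_snd[of "prod_topology T T" T] by (auto simp: closed_map_def)
    then have "openin T (topspace T - snd ` D)" by blast
    also have "topspace T - snd ` D = N"
    proof -
      have D: "((a, b), x) \<in> D \<longleftrightarrow> (a \<otimes> x \<otimes> b \<in> U) \<noteq> (a \<otimes> b \<in> U)"
        if "a \<in> carrier G" "b \<in> carrier G" "x \<in> carrier G" for a b x
        using that by (auto simp: D_def topspace_eq_carrier)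
      have D_c: "a \<in> carrier G" "b \<in> carrier G" "x \<in> carrier G" if "((a, b), x) \<in> D" for a b x
        using that by (auto simp: D_def topspace_eq_carrier)
      have "x \<in> snd ` D \<longleftrightarrow> (\<exists>a b. ((a, b), x) \<in> D)" for x
        by force
      then have snd_D: "x \<in> topspace T - snd ` D \<longleftrightarrow> x \<in> carrier G \<and> (\<forall>a b. ((a, b), x) \<notin> D)" for x
        by (simp add: topspace_eq_carrier)
      show ?thesis
      proof (rule Set.set_eqI, unfold snd_D, rule iffI)
        fix x assume x: "x \<in> carrier G \<and> (\<forall>a b. ((a, b), x) \<notin> D)"
        show "x \<in> N"
        proof (rule NI)
          fix a b assume "a \<in> carrier G" "b \<in> carrier G"
          then show "a \<otimes> x \<otimes> b \<in> U \<longleftrightarrow> a \<otimes> b \<in> U" using D[of a b x] x by simp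
        qed (use x in simp)
      next
        fix x assume x: "x \<in> N"
        have "((a, b), x) \<notin> D" for a b
          using D[of a b x] D_c[of a b x] N[OF x, of a b] by auto
        then show "x \<in> carrier G \<and> (\<forall>a b. ((a, b), x) \<notin> D)" using Nc[OF x] by simp
      qed
    qed
    finally show ?thesis .
  qed
  with normal \<open>N \<subseteq> U\<close> show ?thesis using that by blast
qed

lemma open_normal_subgroup_avoiding:
  assumes "subgroup N G" "openin T N" "x \<in> carrier G" "x \<noteq> \<one>"
  obtains M where "M \<lhd> G" "openin T M" "M \<subseteq> N" "x \<notin> M"
proof -
  obtain U where U: "openin T U" "closedin T U" "\<one> \<in> U" "x \<notin> U"
    using clopen_separation[OF assms(3,4)] by blast
  obtain M where "M \<lhd> G" "openin T M" "M \<subseteq> U \<inter> N"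
    using open_normal_subgroup_in_clopen[of "U \<inter> N"] U assms(2)
      closedin_open_subgroup[OF assms(1,2)] subgroup.one_closed[OF assms(1)]
    by (metis IntI closedin_Int openin_Int)
  with U that show ?thesis by blast
qed

text \<open>
  The Schreier bound without the usual correction by \<open>index - 1\<close> for a spanning tree: since only the
  growth of ranks relative to the index matters, the cruder product bound is enough.
\<close>

lemma top_gen_open_subgroup:
  assumes K: "subgroup K G" "openin T K" and H: "subgroup H G" "K \<subseteq> H" and X: "top_gen H X"
  obtains S where "top_gen K S" "card S \<le> card X * card ((#>) K ` H)"
proof -
  let ?R = "coset_rep G K ` H"
  let ?S = "(\<lambda>(h, x). schreier G K h x) ` (?R \<times> X)"
  have Xfin: "finite X" and XH: "X \<subseteq> H" using X by (auto simp: top_gen_def)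
  have Hc: "h \<in> carrier G" if "h \<in> H" for h using that subgroup.mem_carrier[OF H(1)] by blast
  have "(#>) K ` H \<subseteq> rcosets K" using Hc by (auto simp: RCOSETS_def)
  then have fin: "finite ((#>) K ` H)"
    using finite_rcosets_open_subgroup[OF K] finite_subset by blast
  have "bij_betw ((#>) K) ?R ((#>) K ` H)"
    by (rule bij_betw_coset_reps[OF K(1) H(1)])
  then have finR: "finite ?R" and cardR: "card ?R = card ((#>) K ` H)"
    using fin by (auto simp: bij_betw_finite bij_betw_same_card)
  have "top_gen K ?S"
  proof (rule top_gen_of_schreier[OF K H X])
    show "finite ?S" using finR Xfin by simp
    show "?S \<subseteq> K" using Hc XH by (auto intro!: schreier_closed[OF K(1)] coset_rep_closed[OF K(1)])
    fix h x assume hx: "h \<in> H" "x \<in> X"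
    then have "schreier G K h x = schreier G K (coset_rep G K h) x"
      using schreier_coset_rep[OF K(1)] Hc XH by (metis subset_iff)
    then show "schreier G K h x \<in> generate G ?S" using hx by (intro generate.incl) force
  qed
  moreover have "card ?S \<le> card X * card ((#>) K ` H)"
    using card_image_le[of "?R \<times> X" "\<lambda>(h, x). schreier G K h x"] finR Xfin cardR
    by (simp add: card_cartesian_product mult.commute)
  ultimately show ?thesis using that by blast
qed

end

section \<open>Redundant Schreier generators\<close>

context group
begin

text \<open>
  The relation \<open>w = \<one>\<close> traces a closed path from every vertex \<open>h\<close> of the Schreier graph. As no
  shorter word fixes a vertex, the path visits pairwise distinct vertices and uses its first edge
  once; hence that edge's generator is a product of the generators on the remaining edges. Doing this
  at all vertices of \<open>R\<close> simultaneously is consistent when no path started in \<open>R\<close> meets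
  \<open>R\<close> again before it closes up.

  The generator \<open>i0\<close> is oriented as in the first letter of \<open>w\<close>, which is why all generators
  are taken with the sign \<open>b0\<close>.
\<close>

lemma schreier_redundant:
  assumes K: "K \<lhd> G" and H: "subgroup H G" and y: "y \<in> {..<k} \<rightarrow> H"
    and w: "w = (i0, b0) # v" and red: "reduced w" and wL: "set w \<subseteq> {..<k} \<times> UNIV"
    and rel: "eval_word G y w = \<one>"
    and short: "\<And>u. u \<noteq> [] \<Longrightarrow> reduced u \<Longrightarrow> set u \<subseteq> {..<k} \<times> UNIV \<Longrightarrow>
      length u < length w \<Longrightarrow> eval_word G y u \<notin> K"
    and indep: "\<And>h p. h \<in> H \<Longrightarrow> coset_rep G K h \<in> R \<Longrightarrow> 1 \<le> p \<Longrightarrow> p < length w \<Longrightarrow>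
      coset_rep G K (h \<otimes> eval_word G y (take p w)) \<notin> R"
    and P: "subgroup P G"
    and gen: "\<And>h i. h \<in> H \<Longrightarrow> i < k \<Longrightarrow> \<not> (i = i0 \<and> coset_rep G K h \<in> R) \<Longrightarrow>
      schreier G K h (eval_letter G y (i, b0)) \<in> P"
    and h: "h \<in> H" and i: "i < k"
  shows "schreier G K h (eval_letter G y (i, b0)) \<in> P"
proof (cases "i = i0 \<and> coset_rep G K h \<in> R")
  case False
  then show ?thesis using gen h i by blast
next
  case True
  have Ks: "subgroup K G" using K normal_imp_subgroup by blast
  have Hc: "z \<in> carrier G" if "z \<in> H" for z using that subgroup.mem_carrier[OF H] by blast
  have yc: "y \<in> {..<k} \<rightarrow> carrier G" using y Hc by blast
  have letter_H: "eval_letter G y c \<in> H" if "c \<in> {..<k} \<times> UNIV" for c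
    using that y subgroup.m_inv_closed[OF H] by (auto simp: eval_letter_def Pi_iff)
  have word_H: "eval_word G y u \<in> H" if "set u \<subseteq> {..<k} \<times> UNIV" for u
    using that by (induction u) (auto simp: letter_H subgroup.one_closed[OF H] subgroup.m_closed[OF H])
  let ?a = "(i0, b0)"
  have aL: "?a \<in> {..<k} \<times> UNIV" and vL: "set v \<subseteq> {..<k} \<times> UNIV" using wL w by auto
  \<comment> \<open>The rest of the path stays in \<open>P\<close>, by induction on the part still to be walked.\<close>
  have walk: "schreier G K (h \<otimes> eval_word G y (?a # v1)) (eval_word G y v2) \<in> P" if "v = v1 @ v2" for v1 v2
    using that
  proof (induction v2 arbitrary: v1)
    case Nil
    then have "eval_word G y (?a # v1) \<in> H" using wL w by (intro word_H) auto
    then show ?case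
      using schreier_one[OF Ks] Hc subgroup.m_closed[OF H h] subgroup.one_closed[OF P] by simp
  next
    case (Cons c v2)
    define hh where "hh = h \<otimes> eval_word G y (?a # v1)"
    obtain i b where c: "c = (i, b)" by (cases c)
    have L: "set (?a # v1) \<subseteq> {..<k} \<times> UNIV" "c \<in> {..<k} \<times> UNIV" "set v2 \<subseteq> {..<k} \<times> UNIV"
      using Cons.prems wL w by auto
    have ik: "i < k" using L c by simp
    have hhH: "hh \<in> H" unfolding hh_def using word_H[OF L(1)] by (rule subgroup.m_closed[OF H h])
    have cH: "eval_letter G y c \<in> H" using letter_H L by blast
    have hhc: "hh \<otimes> eval_letter G y c = h \<otimes> eval_word G y (?a # v1 @ [c])"
      using eval_word_append[OF yc L(1), of "[c]"] L word_H[OF L(1)] cH h Hc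
      by (simp add: hh_def m_assoc del: eval_word_Cons) (simp add: m_assoc)
    have rest: "schreier G K (hh \<otimes> eval_letter G y c) (eval_word G y v2) \<in> P"
      using Cons.IH[of "v1 @ [c]"] Cons.prems hhc by simp
    have w1: "w = (?a # v1) @ c # v2" using w Cons.prems by simp
    have not_R: "coset_rep G K hh \<notin> R"
      using indep[OF h conjunct2[OF True], of "length (?a # v1)"] by (simp add: hh_def w1)
    have "schreier G K hh (eval_letter G y c) \<in> P"
    proof (cases "b = b0")
      case True
      then show ?thesis using gen[OF hhH ik] not_R c by simp
    next
      case False
      define A where "A = eval_letter G y (i, b0)"
      have "c = inv_letter (i, b0)" using False c by (auto simp: inv_letter_def)
      then have cA: "eval_letter G y c = inv A"
        using eval_letter_inv_letter[OF yc, of "(i, b0)"] ik by (simp add: A_def)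
      have AH: "A \<in> H" unfolding A_def using letter_H ik by simp
      have not_R': "\<not> (i = i0 \<and> coset_rep G K (hh \<otimes> inv A) \<in> R)"
      proof
        assume bad: "i = i0 \<and> coset_rep G K (hh \<otimes> inv A) \<in> R"
        show False
        proof (cases "v2 = []")
          case False
          then show False
            using indep[OF h conjunct2[OF True], of "length (?a # v1 @ [c])"] bad
            by (simp add: w1 hhc flip: cA)
        next
          case True
          \<comment> \<open>The path could return through its first edge only if \<open>w\<close> were conjugate to a shorter word.\<close>
          have w2: "w = [?a] @ v1 @ [c]" using w1 True by simp
          have "v1 \<noteq> []" using red w2 \<open>c = inv_letter (i, b0)\<close> bad by auto
          moreover have "reduced v1" using red w2 reduced_append by metis
          moreover have V: "eval_word G y v1 \<in> H" using word_H L by simp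
          have "A \<otimes> eval_word G y v1 \<otimes> inv A = \<one>"
            using rel eval_word_append[OF yc, of v1 "[c]"] L V AH Hc bad
            by (simp add: w2 cA m_assoc) (simp add: A_def)
          then have "eval_word G y v1 = \<one>"
            using V AH Hc by (metis inv_closed inv_equality inv_inv l_cancel_one' m_closed r_cancel_one r_inv)
          then have "eval_word G y v1 \<in> K" using subgroup.one_closed[OF Ks] by simp
          ultimately show False using short[of v1] L w2 by simp
        qed
      qed
      have "hh \<otimes> inv A \<in> H" using hhH AH H by (simp add: subgroup.m_closed subgroup.m_inv_closed)
      then have "schreier G K (hh \<otimes> inv A) A \<in> P" using gen ik not_R' by (simp add: A_def)
      then show ?thesis
        using schreier_inv[OF Ks] hhH AH Hc subgroup.m_inv_closed[OF P] by (simp add: cA)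
    qed
    then show ?case
      using rest schreier_mult[OF Ks] Hc hhH cH word_H[OF L(3)] subgroup.m_closed[OF P]
      unfolding hh_def[symmetric] by simp
  qed
  let ?A = "eval_letter G y ?a"
  have cl: "h \<in> carrier G" "?A \<in> carrier G" "eval_word G y v \<in> carrier G"
    using h Hc letter_H[OF aL] word_H[OF vL] by auto
  have tail: "schreier G K (h \<otimes> ?A) (eval_word G y v) \<in> P" using walk[of "[]" v] cl by simp
  have "schreier G K h ?A \<otimes> schreier G K (h \<otimes> ?A) (eval_word G y v) = \<one>"
    using schreier_mult[OF Ks cl] schreier_one[OF Ks cl(1)] rel w by simp
  then have "schreier G K h ?A = inv (schreier G K (h \<otimes> ?A) (eval_word G y v))"
    using inv_equality schreier_in_carrier[OF Ks] cl by (metis m_closed)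
  then show ?thesis using tail subgroup.m_inv_closed[OF P] True by simp
qed

text \<open>
  The digraph joins each coset to the cosets reached from it along the proper nonempty prefixes of
  \<open>w\<close>. Those prefixes lie outside the normal subgroup \<open>K\<close>, so there are no loops, and right
  translations are injective. A tuple \<open>y\<close> congruent to \<open>x\<close> modulo \<open>K\<close> walks through the same cosets,
  so one set \<open>R\<close> serves all such tuples.
\<close>

lemma independent_cosets:
  assumes K: "K \<lhd> G" and H: "subgroup H G" and x: "x \<in> {..<k} \<rightarrow> H"
    and red: "reduced w" and w: "set w \<subseteq> {..<k} \<times> UNIV" "w \<noteq> []"
    and fin: "finite ((#>) K ` H)"
    and short: "\<And>u. u \<noteq> [] \<Longrightarrow> reduced u \<Longrightarrow> set u \<subseteq> {..<k} \<times> UNIV \<Longrightarrow>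
      length u < length w \<Longrightarrow> eval_word G x u \<notin> K"
  obtains R where "R \<subseteq> coset_rep G K ` H" "card ((#>) K ` H) \<le> 2 * length w * card R"
    "\<And>y h p. \<lbrakk>y \<in> {..<k} \<rightarrow> H; \<And>i. i < k \<Longrightarrow> K #> y i = K #> x i; h \<in> H; coset_rep G K h \<in> R;
      1 \<le> p; p < length w\<rbrakk> \<Longrightarrow> coset_rep G K (h \<otimes> eval_word G y (take p w)) \<notin> R"
proof -
  have Ks: "subgroup K G" using K normal_imp_subgroup by blast
  interpret K: normal K G by (rule K)
  have Hc: "z \<in> carrier G" if "z \<in> H" for z using that subgroup.mem_carrier[OF H] by blast
  have word_c: "eval_word G y (take p w) \<in> carrier G" if "y \<in> {..<k} \<rightarrow> H" for y p
    using that Hc w(1) set_take_subset by (intro eval_word_closed[of y k]) fast+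
  let ?V = "coset_rep G K ` H" and ?I = "{1..<length w}"
  let ?f = "\<lambda>p g. coset_rep G K (g \<otimes> eval_word G x (take p w))"
  have Vc: "g \<in> carrier G" if "g \<in> ?V" for g using that Hc coset_rep_closed[OF Ks] by auto
  have V_rep: "coset_rep G K g = g" if "g \<in> ?V" for g
    using that Hc rcos_coset_rep[OF Ks] coset_rep_cong by (metis imageE)
  have bij: "bij_betw ((#>) K) ?V ((#>) K ` H)" by (rule bij_betw_coset_reps[OF Ks H])
  then have finV: "finite ?V" using fin by (simp add: bij_betw_finite)
  have inj: "inj_on (?f p) ?V" for p
  proof (rule inj_onI)
    fix g g' assume g: "g \<in> ?V" "g' \<in> ?V" and eq: "?f p g = ?f p g'"
    then have "K #> (g \<otimes> eval_word G x (take p w)) = K #> (g' \<otimes> eval_word G x (take p w))"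
      using coset_rep_eq_iff[OF Ks] Vc word_c[OF x] by simp
    then have "K #> g = K #> g'"
      by (rule rcos_mult_cancel[OF Ks Vc[OF g(1)] Vc[OF g(2)] word_c[OF x]])
    then show "g = g'" using coset_rep_cong[of K g g'] V_rep[OF g(1)] V_rep[OF g(2)] by simp
  qed
  have no_fix: "?f p g \<noteq> g" if p: "p \<in> ?I" and g: "g \<in> ?V" for p g
  proof
    define q where "q = eval_word G x (take p w)"
    have q: "q \<in> carrier G" using word_c[OF x] q_def by simp
    assume "?f p g = g"
    then have "coset_rep G K (g \<otimes> q) = coset_rep G K g" using V_rep[OF g] by (simp add: q_def)
    then have "K #> (g \<otimes> q) = K #> g"
      using coset_rep_eq_iff[OF Ks m_closed[OF Vc[OF g] q] Vc[OF g]] by simp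
    then have "g \<otimes> q \<in> K #> g"
      using rcos_self[OF m_closed[OF Vc[OF g] q] Ks] by simp
    then have "g \<otimes> q \<otimes> inv g \<in> K"
      using K.rcos_module_imp[OF is_group Vc[OF g]] by blast
    then have "inv g \<otimes> (g \<otimes> q \<otimes> inv g) \<otimes> g \<in> K" by (rule K.inv_op_closed1[OF Vc[OF g]])
    moreover have "inv g \<otimes> (g \<otimes> q \<otimes> inv g) \<otimes> g = q"
    proof -
      have "inv g \<otimes> (g \<otimes> q \<otimes> inv g) \<otimes> g = (inv g \<otimes> g) \<otimes> q \<otimes> (inv g \<otimes> g)"
        using q Vc[OF g] by (simp only: m_assoc m_closed inv_closed)
      then show ?thesis using q Vc[OF g] by simp
    qed
    ultimately have "q \<in> K" by simp
    moreover have "reduced (take p w)" using red reduced_append[of "take p w" "drop p w"] by simp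
    moreover have "set (take p w) \<subseteq> {..<k} \<times> UNIV" using w(1) set_take_subset by fast
    ultimately show False using short[of "take p w"] p w(2) by (auto simp: q_def)
  qed
  obtain R where R: "R \<subseteq> ?V" "\<And>p g. p \<in> ?I \<Longrightarrow> g \<in> R \<Longrightarrow> ?f p g \<notin> R"
    "card ?V \<le> (1 + 2 * card ?I) * card R"
    by (rule independent_set_of_injections[OF finV, of ?I ?f]) (use inj no_fix in auto)
  have "card ((#>) K ` H) \<le> (1 + 2 * card ?I) * card R"
    using R(3) bij_betw_same_card[OF bij] by simp
  also have "\<dots> \<le> 2 * length w * card R"
    using w(2) by (intro mult_right_mono) (cases w; simp)+
  finally have card: "card ((#>) K ` H) \<le> 2 * length w * card R" .
  show ?thesis
  proof (rule that[OF R(1) card])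
    fix y h p
    assume y: "y \<in> {..<k} \<rightarrow> H" and cong: "\<And>i. i < k \<Longrightarrow> K #> y i = K #> x i"
      and h: "h \<in> H" "coset_rep G K h \<in> R" and p: "1 \<le> p" "p < length w"
    have xc: "x \<in> {..<k} \<rightarrow> carrier G" and yc: "y \<in> {..<k} \<rightarrow> carrier G" using x y Hc by blast+
    have "set (take p w) \<subseteq> {..<k} \<times> UNIV" using w(1) set_take_subset by fast
    with K.rcos_eval_word_cong[OF yc xc cong]
    have "K #> eval_word G y (take p w) = K #> eval_word G x (take p w)" by blast
    then have "K #> (h \<otimes> eval_word G y (take p w)) =
        K #> (coset_rep G K h \<otimes> eval_word G x (take p w))"
      using K.rcos_sum[OF Hc[OF h(1)] word_c[OF y], of p, symmetric] rcos_coset_rep[OF Ks Hc[OF h(1)]]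
        K.rcos_sum[OF coset_rep_closed[OF Ks Hc[OF h(1)]] word_c[OF x], of p, symmetric]
      by simp
    from coset_rep_cong[OF this] show "coset_rep G K (h \<otimes> eval_word G y (take p w)) \<notin> R"
      using R(2)[of p "coset_rep G K h"] h p by simp
  qed
qed

end

section \<open>Coset laws\<close>

text \<open>
  The word \<open>w\<close> vanishes on a whole product of cosets of an open normal subgroup. Unlike laws,
  coset laws behave well under finite unions: if finitely many words cover such a product by their
  zero sets, then one of them vanishes on a smaller product of this kind.
\<close>

definition coset_law :: "('a, 'b) monoid_scheme \<Rightarrow> 'a topology \<Rightarrow> 'a set \<Rightarrow> nat \<Rightarrow> letter list \<Rightarrow> bool" where
  "coset_law G T H k w \<longleftrightarrow>
     (\<exists>g N. g \<in> {..<k} \<rightarrow> H \<and> N \<lhd> G \<and> openin T N \<and> N \<subseteq> H \<and>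
        (\<forall>y \<in> {..<k} \<rightarrow> carrier G. (\<forall>i<k. y i \<in> N #>\<^bsub>G\<^esub> g i) \<longrightarrow>
           eval_word G y w = \<one>\<^bsub>G\<^esub>))"

definition words :: "nat \<Rightarrow> letter list set" where
  "words k = {w. reduced w \<and> w \<noteq> [] \<and> set w \<subseteq> {..<k} \<times> UNIV}"

lemma finite_words_shorter: "finite {w \<in> words k. length w < n}"
  by (rule finite_subset[OF _ finite_lists_length_le[of "{..<k} \<times> (UNIV :: bool set)" n]])
    (auto simp: words_def)

context profinite_group
begin

text \<open>
  The words are treated one after the other. Each of them fails on the current product of cosets, so
  it is nontrivial at some tuple there; shrinking the product around this tuple keeps the value of the
  word outside the new normal subgroup, and the earlier words remain nontrivial.
\<close>

lemma tuple_avoiding_words: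
  assumes H: "subgroup H G"
    and N: "g \<in> {..<k} \<rightarrow> H" "N \<lhd> G" "openin T N" "N \<subseteq> H"
    and F: "finite F" "F \<subseteq> words k" "\<And>u. u \<in> F \<Longrightarrow> \<not> coset_law G T H k u"
  shows "\<exists>x K. x \<in> {..<k} \<rightarrow> H \<and> (\<forall>i<k. x i \<in> N #> g i) \<and> K \<lhd> G \<and> openin T K \<and> K \<subseteq> N \<and>
    (\<forall>u\<in>F. eval_word G x u \<notin> K)"
  using F
proof (induction F rule: finite_induct)
  case empty
  have "g i \<in> N #> g i" if "i < k" for i
    using that N subgroup.mem_carrier[OF H] rcos_self[OF _ normal_imp_subgroup[OF N(2)]] by auto
  then show ?case using N by (intro exI[of _ g] exI[of _ N]) auto
next
  case (insert u F)
  then obtain x K where x: "x \<in> {..<k} \<rightarrow> H" "\<forall>i<k. x i \<in> N #> g i"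
    and K: "K \<lhd> G" "openin T K" "K \<subseteq> N" and F: "\<forall>v\<in>F. eval_word G x v \<notin> K"
    by auto
  have uL: "set u \<subseteq> {..<k} \<times> UNIV" using insert.prems by (auto simp: words_def)
  have "\<not> coset_law G T H k u" using insert.prems by simp
  then obtain y where y: "y \<in> {..<k} \<rightarrow> carrier G" "\<forall>i<k. y i \<in> K #> x i" "eval_word G y u \<noteq> \<one>"
    unfolding coset_law_def using x(1) K N(4) by blast
  have Hc: "z \<in> carrier G" if "z \<in> H" for z using that subgroup.mem_carrier[OF H] by blast
  have xc: "x \<in> {..<k} \<rightarrow> carrier G" using x Hc by blast
  have Ks: "subgroup K G" and Ns: "subgroup N G" using K N normal_imp_subgroup by blast+
  obtain M where M: "M \<lhd> G" "openin T M" "M \<subseteq> K" "eval_word G y u \<notin> M"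
    using open_normal_subgroup_avoiding[OF Ks K(2) eval_word_closed[OF y(1) uL] y(3)] by blast
  have yH: "y i \<in> H" and yN: "y i \<in> N #> g i" if i: "i < k" for i
  proof -
    obtain a where a: "a \<in> K" "y i = a \<otimes> x i" using y(2) i by (auto simp: r_coset_def)
    obtain b where b: "b \<in> N" "x i = b \<otimes> g i" using x(2) i by (auto simp: r_coset_def)
    have "g i \<in> carrier G" using N(1) i Hc by blast
    then have "y i = (a \<otimes> b) \<otimes> g i"
      using a b K(3) subgroup.mem_carrier[OF Ns] by (auto simp: m_assoc)
    moreover have "a \<otimes> b \<in> N" using a b K(3) subgroup.m_closed[OF Ns] by blast
    ultimately show "y i \<in> N #> g i" unfolding r_coset_def by blast
    have "x i \<in> H" using x(1) i by auto
    moreover have "a \<in> H" using a K(3) N(4) by blast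
    ultimately show "y i \<in> H" using a(2) subgroup.m_closed[OF H] by simp
  qed
  have eq: "K #> y i = K #> x i" if "i < k" for i
    using repr_independence[OF _ _ Ks, of "y i" "x i"] y(2) Pi_mem[OF xc, of i] that by simp
  have "eval_word G y v \<notin> M" if v: "v \<in> F" for v
  proof
    assume "eval_word G y v \<in> M"
    then have "eval_word G y v \<in> K" using M by blast
    have vL: "set v \<subseteq> {..<k} \<times> UNIV" using insert.prems v by (auto simp: words_def)
    have "K #> eval_word G x v = K #> eval_word G y v"
      using normal.rcos_eval_word_cong[OF K(1) y(1) xc eq vL] by simp
    also have "\<dots> = K"
      using coset_join2[OF eval_word_closed[OF y(1) vL] Ks \<open>eval_word G y v \<in> K\<close>] .
    finally have "eval_word G x v \<in> K"
      using coset_join1[OF _ eval_word_closed[OF xc vL] Ks] by blast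
    then show False using F v by blast
  qed
  then show ?case
    using yH yN M K(3) by (intro exI[of _ y] exI[of _ M]) auto
qed

section \<open>Counting generators\<close>

text \<open>
  Every generator of \<open>H\<close> has the form \<open>m \<otimes> l\<close> with \<open>m \<in> K\<close> and \<open>l\<close> in the subgroup generated by the
  \<open>x i\<close>. So the \<open>x i\<close> together with the elements \<open>m\<close> generate \<open>H\<close>, and replacing the elements \<open>m\<close>
  by the products \<open>m \<otimes> x i\<close> arranges them in blocks that are all congruent to \<open>x\<close> modulo \<open>K\<close>. This
  costs at most \<open>2 * k\<close> generators in addition to \<open>card S\<close>.
\<close>

lemma top_gen_blocks:
  assumes K: "subgroup K G" "openin T K" and H: "subgroup H G" "K \<subseteq> H" and k: "k \<ge> 1"
    and x: "x \<in> {..<k} \<rightarrow> H" and HK: "H \<subseteq> K <#> generate G (x ` {..<k})"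
    and S: "top_gen H S"
  obtains X where "\<And>j i. i < k \<Longrightarrow> X j i \<in> K #> x i"
    "top_gen H ((\<lambda>(j, i). X j i) ` ({..card S div k + 1} \<times> {..<k}))"
proof -
  have Hc: "z \<in> carrier G" if "z \<in> H" for z using that subgroup.mem_carrier[OF H(1)] by blast
  have finS: "finite S" and SH: "S \<subseteq> H" and dense: "H \<subseteq> T closure_of generate G S"
    using S by (auto simp: top_gen_def)
  let ?d = "card S" and ?L = "generate G (x ` {..<k})"
  have xH: "x ` {..<k} \<subseteq> H" using x by blast
  then have xc: "x ` {..<k} \<subseteq> carrier G" using Hc by blast
  obtain s where s: "bij_betw s {0..<?d} S" using ex_bij_betw_nat_finite[OF finS] by blast
  have "\<exists>m\<in>K. \<exists>l\<in>?L. s a = m \<otimes> l" if "a < ?d" for a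
    using that s SH HK unfolding bij_betw_def set_mult_def by fastforce
  then obtain m l where ml: "\<And>a. a < ?d \<Longrightarrow> m a \<in> K" "\<And>a. a < ?d \<Longrightarrow> l a \<in> ?L"
    "\<And>a. a < ?d \<Longrightarrow> s a = m a \<otimes> l a"
    by metis
  \<comment> \<open>The identity pads the last block.\<close>
  define m' where "m' a = (if a < ?d then m a else \<one>)" for a
  have m'K: "m' a \<in> K" for a using ml subgroup.one_closed[OF K(1)] by (simp add: m'_def)
  have Kc: "z \<in> carrier G" if "z \<in> K" for z using that H(2) Hc by blast
  \<comment> \<open>Block \<open>0\<close> is \<open>x\<close>; the element \<open>m a\<close> sits in block \<open>a div k + 1\<close> at position \<open>a mod k\<close>.\<close>
  define X where "X j i = (if j = 0 then x i else m' ((j - 1) * k + i) \<otimes> x i)" for j i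
  have X_coset: "X j i \<in> K #> x i" if "i < k" for j i
  proof (cases "j = 0")
    case True
    then show ?thesis using rcos_self[OF _ K(1), of "x i"] xc that by (auto simp: X_def)
  next
    case False
    then show ?thesis using m'K unfolding X_def r_coset_def by auto
  qed
  have XH: "X j i \<in> H" if "i < k" for j i
  proof -
    have "x i \<in> H" using x that by auto
    moreover have "m' a \<in> H" for a using m'K H(2) by blast
    ultimately show ?thesis using subgroup.m_closed[OF H(1)] by (simp add: X_def)
  qed
  let ?X = "(\<lambda>(j, i). X j i) ` ({..?d div k + 1} \<times> {..<k})"
  have XH': "?X \<subseteq> H" using XH by auto
  then have gen_sub: "subgroup (generate G ?X) G"
    using Hc by (intro generate_is_subgroup) blast
  have X_gen: "X j i \<in> generate G ?X" if "j \<le> ?d div k + 1" "i < k" for j i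
    using that by (intro generate.incl) force
  have x_gen: "x i \<in> generate G ?X" if "i < k" for i
    using X_gen[of 0 i] that by (simp add: X_def)
  then have L_gen: "?L \<subseteq> generate G ?X"
    by (intro generate_subgroup_incl gen_sub) auto
  have m_gen: "m a \<in> generate G ?X" if a: "a < ?d" for a
  proof -
    have ik: "a mod k < k" using k by simp
    have "a div k \<le> ?d div k" using a by (simp add: div_le_mono)
    then have "X (Suc (a div k)) (a mod k) \<in> generate G ?X" using ik by (intro X_gen) auto
    moreover have "X (Suc (a div k)) (a mod k) = m a \<otimes> x (a mod k)"
      using a by (simp add: X_def m'_def)
    moreover have "m a \<in> carrier G" "x (a mod k) \<in> carrier G"
      using ml(1)[OF a] Kc x ik Hc by auto
    ultimately have "m a = X (Suc (a div k)) (a mod k) \<otimes> inv x (a mod k)"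
      by (simp add: m_assoc)
    then show ?thesis
      using \<open>X (Suc (a div k)) (a mod k) \<in> generate G ?X\<close> x_gen[OF ik]
        subgroup.m_closed[OF gen_sub] subgroup.m_inv_closed[OF gen_sub] by simp
  qed
  have "S \<subseteq> generate G ?X"
  proof
    fix z assume "z \<in> S"
    then obtain a where "a < ?d" "z = s a"
      using s unfolding bij_betw_def by (metis atLeastLessThan_iff imageE)
    then show "z \<in> generate G ?X"
      using ml(3) subgroup.m_closed[OF gen_sub m_gen subsetD[OF L_gen ml(2)]] by simp
  qed
  then have "generate G S \<subseteq> generate G ?X" by (rule generate_subgroup_incl[OF _ gen_sub])
  then have "H \<subseteq> T closure_of generate G ?X" using dense closure_of_mono by fast
  then have "top_gen H ?X" using XH' by (simp add: top_gen_def)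
  with X_coset that show ?thesis by blast
qed

text \<open>
  Each block other than \<open>x\<close> itself satisfies the relation \<open>w\<close> at every vertex of the Schreier graph
  of \<open>K\<close> and makes at least \<open>card ((#>) K ` H) / (2 * length w)\<close> Schreier generators redundant. The
  relations of different blocks involve different edges, so the savings add up.
\<close>

lemma generators_saved_by_coset_law:
  assumes K: "K \<lhd> G" "openin T K" and H: "subgroup H G" "K \<subseteq> H" and k: "k \<ge> 1"
    and x: "x \<in> {..<k} \<rightarrow> H" and HK: "H \<subseteq> K <#> generate G (x ` {..<k})"
    and S: "top_gen H S"
    and w: "w \<in> words k"
    and law: "\<And>y. y \<in> {..<k} \<rightarrow> carrier G \<Longrightarrow> (\<And>i. i < k \<Longrightarrow> y i \<in> K #> x i) \<Longrightarrow> eval_word G y w = \<one>"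
    and short: "\<And>u. u \<in> words k \<Longrightarrow> length u < length w \<Longrightarrow> eval_word G x u \<notin> K"
  obtains S' \<rho> where "top_gen K S'" "card ((#>) K ` H) \<le> 2 * length w * \<rho>"
    "card S' + (card S div k + 1) * \<rho> \<le> card ((#>) K ` H) * ((card S div k + 2) * k)"
proof -
  have Ks: "subgroup K G" using K normal_imp_subgroup by blast
  have Hc: "z \<in> carrier G" if "z \<in> H" for z using that subgroup.mem_carrier[OF H(1)] by blast
  have red: "reduced w" and wL: "set w \<subseteq> {..<k} \<times> UNIV" and wne: "w \<noteq> []"
    using w by (auto simp: words_def)
  let ?V = "coset_rep G K ` H" and ?n = "card ((#>) K ` H)" and ?J = "card S div k + 1"
  have "(#>) K ` H \<subseteq> rcosets K" using Hc by (auto simp: RCOSETS_def)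
  then have fin: "finite ((#>) K ` H)"
    using finite_rcosets_open_subgroup[OF Ks K(2)] by (rule finite_subset)
  have bij: "bij_betw ((#>) K) ?V ((#>) K ` H)" by (rule bij_betw_coset_reps[OF Ks H(1)])
  have finV: "finite ?V" and cardV: "card ?V = ?n"
    using bij fin by (auto simp: bij_betw_finite bij_betw_same_card)
  have short_x: "eval_word G x u \<notin> K"
    if "u \<noteq> []" "reduced u" "set u \<subseteq> {..<k} \<times> UNIV" "length u < length w" for u
    using short that by (simp add: words_def)
  obtain R where R: "R \<subseteq> ?V" and cardR: "?n \<le> 2 * length w * card R"
    and indep: "\<And>y h p. \<lbrakk>y \<in> {..<k} \<rightarrow> H; \<And>i. i < k \<Longrightarrow> K #> y i = K #> x i; h \<in> H;
      coset_rep G K h \<in> R; 1 \<le> p; p < length w\<rbrakk>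
      \<Longrightarrow> coset_rep G K (h \<otimes> eval_word G y (take p w)) \<notin> R"
    using independent_cosets[OF K(1) H(1) x red wL wne fin short_x] by blast
  obtain X where X: "\<And>j i. i < k \<Longrightarrow> X j i \<in> K #> x i"
    and X_gen: "top_gen H ((\<lambda>(j, i). X j i) ` ({..?J} \<times> {..<k}))"
    using top_gen_blocks[OF Ks K(2) H k x HK S] by blast
  have XH: "X j i \<in> H" if i: "i < k" for j i
  proof -
    have "x i \<in> H" using x i by auto
    moreover obtain a where "a \<in> K" "X j i = a \<otimes> x i" using X[OF i] by (auto simp: r_coset_def)
    ultimately show ?thesis using subgroup.m_closed[OF H(1) subsetD[OF H(2)]] by simp
  qed
  then have XPi: "X j \<in> {..<k} \<rightarrow> H" and XPc: "X j \<in> {..<k} \<rightarrow> carrier G" for j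
    using Hc by auto
  have X_eq: "K #> X j i = K #> x i" if "i < k" for j i
  proof -
    have "x i \<in> carrier G" using x that Hc by auto
    then show ?thesis using repr_independence[OF X[OF that] _ Ks] by simp
  qed
  obtain i0 b0 v where w_eq: "w = (i0, b0) # v" using wne by (cases w) auto
  have i0: "i0 < k" using wL w_eq by simp
  define Y where "Y = (\<lambda>(j, i). eval_letter G (X j) (i, b0))"
  have Y: "Y (j, i) = eval_letter G (X j) (i, b0)" for j i by (simp add: Y_def)
  have YH: "Y (j, i) \<in> H" if "i < k" for j i
    using XH[OF that] subgroup.m_inv_closed[OF H(1)] by (simp add: Y eval_letter_def)
  let ?I = "{..?J} \<times> {..<k}"
  have Y_gen: "top_gen H (Y ` ?I)"
  proof -
    have YI: "Y ` ?I \<subseteq> H" using YH by auto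
    then have sub: "subgroup (generate G (Y ` ?I)) G" using Hc by (intro generate_is_subgroup) blast
    have "X j i \<in> generate G (Y ` ?I)" if "j \<le> ?J" "i < k" for j i
    proof -
      have "Y (j, i) \<in> generate G (Y ` ?I)" using that by (intro generate.incl) blast
      moreover have "X j i = (if b0 then Y (j, i) else inv Y (j, i))"
        using XH[OF that(2)] Hc by (simp add: Y eval_letter_def)
      ultimately show ?thesis using subgroup.m_inv_closed[OF sub] by simp
    qed
    then have "(\<lambda>(j, i). X j i) ` ?I \<subseteq> generate G (Y ` ?I)" by auto
    from closure_of_mono[OF generate_subgroup_incl[OF this sub]]
    have "H \<subseteq> T closure_of generate G (Y ` ?I)"
      using X_gen unfolding top_gen_def by (meson subset_trans)
    then show ?thesis using YI by (simp add: top_gen_def)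
  qed
  \<comment> \<open>all edges of the Schreier graph except the redundant ones\<close>
  define Idx where "Idx = ?V \<times> ?I - R \<times> ({1..?J} \<times> {i0})"
  define S' where "S' = (\<lambda>(h, q). schreier G K h (Y q)) ` Idx"
  have finI: "finite Idx" using finV by (simp add: Idx_def)
  have S'_gen: "schreier G K h (Y (j, i)) \<in> generate G S'"
    if "h \<in> H" "j \<le> ?J" "i < k" "j = 0 \<or> \<not> (i = i0 \<and> coset_rep G K h \<in> R)" for h j i
  proof -
    have "(coset_rep G K h, (j, i)) \<in> Idx" using that by (auto simp: Idx_def)
    then have "schreier G K (coset_rep G K h) (Y (j, i)) \<in> S'" by (force simp: S'_def)
    then show ?thesis
      using schreier_coset_rep[OF Ks Hc[OF that(1)] Hc[OF YH[OF that(3)]]] by (simp add: generate.incl)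
  qed
  have S'K: "S' \<subseteq> K"
  proof -
    have "schreier G K h (Y q) \<in> K" if "(h, q) \<in> Idx" for h q
      using that Hc YH by (intro schreier_closed[OF Ks]) (auto simp: Idx_def coset_rep_closed[OF Ks])
    then show ?thesis by (auto simp: S'_def)
  qed
  then have sub: "subgroup (generate G S') G"
    using subgroup.subset[OF Ks] by (intro generate_is_subgroup) blast
  have "top_gen K S'"
  proof (rule top_gen_of_schreier[OF Ks K(2) H Y_gen _ S'K])
    show "finite S'" using finI by (simp add: S'_def)
    fix h z assume h: "h \<in> H" and "z \<in> Y ` ?I"
    then obtain j i where ji: "j \<le> ?J" "i < k" "z = Y (j, i)" by auto
    show "schreier G K h z \<in> generate G S'"
    proof (cases "j = 0")
      case True
      then show ?thesis using S'_gen h ji by simp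
    next
      case False
      have short_X: "eval_word G (X j) u \<notin> K"
        if "u \<noteq> []" "reduced u" "set u \<subseteq> {..<k} \<times> UNIV" "length u < length w" for u
      proof
        have xc: "x \<in> {..<k} \<rightarrow> carrier G" using x Hc by blast
        assume "eval_word G (X j) u \<in> K"
        then have "K #> eval_word G (X j) u = K"
          by (rule coset_join2[OF eval_word_closed[OF XPc that(3)] Ks])
        then have "K #> eval_word G x u = K"
          using normal.rcos_eval_word_cong[OF K(1) XPc xc X_eq that(3), of j] by simp
        then have "eval_word G x u \<in> K"
          using coset_join1[OF _ eval_word_closed[OF xc that(3)] Ks] by blast
        then show False using short_x that by blast
      qed
      have "schreier G K h (eval_letter G (X j) (i, b0)) \<in> generate G S'"
      proof (rule schreier_redundant[OF K(1) H(1) XPi w_eq red wL _ short_X _ sub _ h ji(2)])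
        show "eval_word G (X j) w = \<one>" by (rule law[OF XPc X])
        show "coset_rep G K (h' \<otimes> eval_word G (X j) (take p w)) \<notin> R"
          if "h' \<in> H" "coset_rep G K h' \<in> R" "1 \<le> p" "p < length w" for h' p
          by (rule indep[OF XPi X_eq that])
        show "schreier G K h' (eval_letter G (X j) (i', b0)) \<in> generate G S'"
          if "h' \<in> H" "i' < k" "\<not> (i' = i0 \<and> coset_rep G K h' \<in> R)" for h' i'
          using S'_gen[OF that(1) ji(1) that(2)] that(3) by (simp add: Y)
      qed
      then show ?thesis using ji by (simp add: Y)
    qed
  qed
  moreover have "card S' + ?J * card R \<le> ?n * ((card S div k + 2) * k)"
  proof -
    let ?B = "R \<times> ({1..?J} \<times> {i0})"
    have sub: "?B \<subseteq> ?V \<times> ?I" using R i0 by auto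
    have fin_prod: "finite (?V \<times> ?I)" using finV by simp
    have "card S' \<le> card Idx" unfolding S'_def by (rule card_image_le[OF finI])
    also have "card Idx = card (?V \<times> ?I) - card ?B"
      unfolding Idx_def by (rule card_Diff_subset[OF finite_subset[OF sub fin_prod] sub])
    finally have "card S' + card ?B \<le> card (?V \<times> ?I)"
      using card_mono[OF fin_prod sub] by linarith
    moreover have "card (?V \<times> ?I) = ?n * ((card S div k + 2) * k)"
      by (simp only: card_cartesian_product cardV) simp
    moreover have "card ?B = ?J * card R"
      by (simp only: card_cartesian_product) simp
    ultimately show ?thesis by (simp only:)
  qed
  ultimately show ?thesis using that cardR by blast
qed

end

section \<open>Rank gradient\<close>

text \<open>
  Here \<open>d\<close> and \<open>D\<close> are the ranks of \<open>H\<close> and of its subgroup \<open>K\<close> of index \<open>n\<close>, and \<open>M\<close> is the index of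
  \<open>H\<close>. With \<open>e = 1 / (4 * k * l0)\<close>, the lower bound says that passing from \<open>H\<close> to \<open>K\<close> loses at most a
  proportion \<open>e\<close> of the generators, whereas the relations save a proportion \<open>2 * e\<close>; the bounded
  excess \<open>2 * k\<close> cannot compensate for this once \<open>d\<close> is large.
\<close>

lemma saving_contradiction:
  fixes k l0 d D J n \<rho> M :: nat and c :: real
  assumes pos: "k \<ge> 1" "l0 \<ge> 1" "n \<ge> 1" "c > 0"
    and lower: "c * (M * n) \<le> D"
    and upper: "d < c * (1 + 1 / (4 * k * l0)) * M"
    and J: "d \<le> k * J" "k * J \<le> d + k"
    and saved: "D + J * \<rho> \<le> n * ((J + 1) * k)" "n \<le> 2 * l0 * \<rho>"
    and large: "d > 8 * k ^ 2 * l0"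
  shows False
proof -
  define e :: real where "e = 1 / (4 * k * l0)"
  have e: "e > 0" "e * (4 * k * l0) = 1" using pos by (auto simp: e_def)
  have "real d * n \<le> real (k * J) * real (2 * l0 * \<rho>)"
    using J(1) saved(2) by (intro mult_mono) (simp_all only: of_nat_le_iff of_nat_0_le_iff)
  then have "2 * e * (real d * n) \<le> 2 * e * (real (k * J) * real (2 * l0 * \<rho>))"
    using e by (intro mult_left_mono) auto
  also have "\<dots> = (e * (4 * k * l0)) * (real J * real \<rho>)" by simp
  finally have save: "2 * e * (real d * n) \<le> real J * real \<rho>" by (simp only: e(2) mult_1)
  have "real (D + J * \<rho>) \<le> real (n * ((J + 1) * k))" using saved(1) by (simp only: of_nat_le_iff)
  also have "\<dots> = real n * real (k * J + k)" by (simp add: algebra_simps)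
  also have "\<dots> \<le> real n * real (d + 2 * k)"
    using J(2) by (intro mult_left_mono) (auto simp only: of_nat_le_iff of_nat_0_le_iff)
  finally have "D \<le> real n * (d + 2 * k) - J * \<rho>" by simp
  with save have D: "D \<le> real n * (d + 2 * k - 2 * e * d)" by (simp add: algebra_simps)
  have "real n * d < real n * (c * (1 + e) * M)"
    using upper pos(3) by (intro mult_strict_left_mono) (auto simp: e_def)
  also have "\<dots> = (1 + e) * (c * (M * n))" by simp
  also have "\<dots> \<le> (1 + e) * D" using lower e by (intro mult_left_mono) auto
  also have "\<dots> \<le> (1 + e) * (real n * (d + 2 * k - 2 * e * d))" using D e by (intro mult_left_mono) auto
  finally have "real n * d < real n * ((1 + e) * (d + 2 * k - 2 * e * d))" by (simp add: mult_ac)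
  then have "real d < (1 + e) * (d + 2 * k - 2 * e * d)" using pos(3) by simp
  then have "e * d * (1 + 2 * e) < 2 * k * (1 + e)" by (simp add: algebra_simps)
  also have "\<dots> \<le> 2 * k * (1 + 2 * e)" using e by (intro mult_left_mono) auto
  finally have "e * d < 2 * k" using e by (simp add: mult_less_cancel_right)
  moreover have "e * d \<ge> 2 * k"
  proof -
    have "2 * k = e * (4 * k * l0) * (2 * k)" by (simp only: e(2) mult_1)
    also have "\<dots> = e * real (8 * k ^ 2 * l0)" by (simp add: power2_eq_square)
    also have "\<dots> \<le> e * real d"
      using large e by (intro mult_left_mono) (auto simp only: of_nat_le_iff)
    finally show ?thesis by simp
  qed
  ultimately show False by simp
qed

context profinite_group
begin

lemma open_subgroup_rank_attained:
  assumes fg: "top_finitely_generated G T" and H: "subgroup H G" "openin T H"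
  shows "\<exists>S. top_gen H S \<and> card S = subgroup_rank H \<and>
    top_rank (G\<lparr>carrier := H\<rparr>) (subtopology T H) = enat (subgroup_rank H)"
proof -
  obtain X where "finite X" "top_generates G T X" using fg by (auto simp: top_finitely_generated_def)
  then have "top_gen (carrier G) X" by (auto simp: top_gen_def top_generates_def)
  then obtain S where "top_gen H S"
    using top_gen_open_subgroup[OF H subgroup_self subgroup.subset[OF H(1)]] by blast
  then show ?thesis using top_rank_attained[OF H(1)] by metis
qed

lemma rank_gradient_pos_bound:
  assumes fg: "top_finitely_generated G T" and rg: "rank_gradient G T > 0"
  obtains r :: real where "r > 0"
    "\<forall>H. subgroup H G \<and> openin T H \<longrightarrow> 1 + r * card (rcosets H) \<le> subgroup_rank H"
proof -
  obtain r where r: "0 < ereal r" "ereal r < rank_gradient G T"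
    using ereal_dense2[OF rg] by blast
  have "1 + r * card (rcosets H) \<le> subgroup_rank H" if H: "subgroup H G" "openin T H" for H
  proof -
    have rk: "top_rank (G\<lparr>carrier := H\<rparr>) (subtopology T H) = enat (subgroup_rank H)"
      using open_subgroup_rank_attained[OF fg H] by blast
    have "rank_gradient G T \<le>
        (ereal_of_enat (top_rank (G\<lparr>carrier := H\<rparr>) (subtopology T H)) - 1) / ereal (card (rcosets H))"
      unfolding rank_gradient_def using H by (intro INF_lower) simp
    also have "\<dots> = ereal ((real (subgroup_rank H) - 1) / card (rcosets H))"
      using card_rcosets_pos[OF H] by (simp add: rk one_ereal_def)
    finally have "ereal r < ereal ((real (subgroup_rank H) - 1) / card (rcosets H))"
      using r(2) by (rule order_less_le_trans[rotated])
    then show ?thesis using card_rcosets_pos[OF H] by (simp add: field_simps)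
  qed
  with r(1) show ?thesis by (intro that[of r]) auto
qed

text \<open>
  As no open subgroup is trivial, each can be made properly smaller, which at least doubles the
  index.
\<close>

lemma open_subgroup_of_large_index:
  assumes nontriv: "\<And>H. subgroup H G \<Longrightarrow> openin T H \<Longrightarrow> H \<noteq> {\<one>}"
    and H0: "subgroup H0 G" "openin T H0"
  shows "\<exists>H. subgroup H G \<and> openin T H \<and> H \<subseteq> H0 \<and> m \<le> card (rcosets H)"
proof (induction m)
  case 0
  then show ?case using H0 by blast
next
  case (Suc m)
  then obtain H where H: "subgroup H G" "openin T H" "H \<subseteq> H0" "m \<le> card (rcosets H)" by blast
  obtain x where x: "x \<in> H" "x \<noteq> \<one>"
    using nontriv[OF H(1,2)] subgroup.one_closed[OF H(1)] by blast
  have xc: "x \<in> carrier G" using subgroup.mem_carrier[OF H(1)] x by blast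
  obtain M where M: "M \<lhd> G" "openin T M" "M \<subseteq> H" "x \<notin> M"
    using open_normal_subgroup_avoiding[OF H(1,2) xc x(2)] by blast
  have Ms: "subgroup M G" using M normal_imp_subgroup by blast
  have finM: "finite (rcosets M)" by (rule finite_rcosets_open_subgroup[OF Ms M(2)])
  have "(#>) M ` H \<subseteq> rcosets M"
    using subgroup.mem_carrier[OF H(1)] by (auto simp: RCOSETS_def)
  then have fin: "finite ((#>) M ` H)" using finM by (rule finite_subset)
  have ne: "M #> x \<noteq> M #> \<one>"
    using rcos_self[OF xc Ms] M(4) subgroup.subset[OF Ms] by (metis coset_mult_one)
  have "card {M #> x, M #> \<one>} \<le> card ((#>) M ` H)"
    using x(1) subgroup.one_closed[OF H(1)] by (intro card_mono[OF fin]) blast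
  then have two: "2 \<le> card ((#>) M ` H)" using ne by simp
  have "card (rcosets M) = card (rcosets H) * card ((#>) M ` H)"
    by (rule card_rcosets_tower[OF Ms H(1) M(3) finM])
  then have "card (rcosets H) * 2 \<le> card (rcosets M)" using two by simp
  then have "Suc m \<le> card (rcosets M)" using H(4) card_rcosets_pos[OF H(1,2)] by linarith
  then show ?case using Ms M H(3) by blast
qed

text \<open>
  A law is in particular a coset law, for the cosets of the identity.
\<close>

lemma shortest_coset_law:
  assumes w: "w \<in> words k" and law: "\<And>g. g \<in> {..<k} \<rightarrow> carrier G \<Longrightarrow> eval_word G g w = \<one>"
    and H: "subgroup H G" "openin T H"
  obtains v where "v \<in> words k" "coset_law G T H k v" "length v \<le> length w"
    "\<And>u. u \<in> words k \<Longrightarrow> length u < length v \<Longrightarrow> \<not> coset_law G T H k u"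
proof -
  obtain N where "N \<lhd> G" "openin T N" "N \<subseteq> H"
    using open_normal_subgroup_in_clopen[OF H(2) closedin_open_subgroup[OF H] subgroup.one_closed[OF H(1)]]
    by blast
  then have "coset_law G T H k w"
    unfolding coset_law_def using law subgroup.one_closed[OF H(1)]
    by (intro exI[of _ "\<lambda>_. \<one>"] exI[of _ N]) auto
  then have "\<exists>v. (v \<in> words k \<and> coset_law G T H k v) \<and>
      (\<forall>u. (u \<in> words k \<and> coset_law G T H k u) \<longrightarrow> length v \<le> length u)"
    using ex_has_least_nat[of "\<lambda>v. v \<in> words k \<and> coset_law G T H k v" w length] w by blast
  then obtain v where v: "v \<in> words k" "coset_law G T H k v"
    "\<And>u. u \<in> words k \<Longrightarrow> coset_law G T H k u \<Longrightarrow> length v \<le> length u" by blast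
  show ?thesis
    using v(3)[OF w \<open>coset_law G T H k w\<close>] v(3) by (intro that[OF v(1,2)]) (auto simp: not_le[symmetric])
qed

text \<open>
  The quantity \<open>c\<close> is the infimum of rank divided by index. It is positive, and below \<open>H0\<close>, where
  this ratio is nearly minimal, it stays nearly minimal. This gives subgroups in which ranks grow almost
  as fast as in a free group, contradicting the saving caused by a shortest coset law.
\<close>

lemma no_law_of_positive_rank_gradient:
  assumes fg: "top_finitely_generated G T" and rg: "rank_gradient G T > 0"
    and k: "k \<ge> 1" and w0: "w0 \<in> words k"
    and law: "\<And>g. g \<in> {..<k} \<rightarrow> carrier G \<Longrightarrow> eval_word G g w0 = \<one>"
  shows False
proof -
  obtain r :: real where r: "r > 0"
    and r_bound: "\<forall>H. subgroup H G \<and> openin T H \<longrightarrow> 1 + r * card (rcosets H) \<le> subgroup_rank H"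
    by (rule rank_gradient_pos_bound[OF fg rg])
  have rank_ge: "1 + r * card (rcosets H) \<le> subgroup_rank H"
    if "subgroup H G" "openin T H" for H
    using r_bound that by blast
  have gens: "\<exists>S. top_gen H S \<and> card S = subgroup_rank H" if "subgroup H G" "openin T H" for H
    using open_subgroup_rank_attained[OF fg that] by blast
  define os where "os = {H. subgroup H G \<and> openin T H}"
  define q where "q H = real (subgroup_rank H) / card (rcosets H)" for H
  \<comment> \<open>Rank rather than rank minus one: then the crude Schreier bound makes \<open>q\<close> monotone.\<close>
  define c where "c = Inf (q ` os)"
  have idx_pos: "0 < card (rcosets H)" if "H \<in> os" for H
    using that card_rcosets_pos by (simp add: os_def)
  have q_ge: "r \<le> q H" if "H \<in> os" for H
    using rank_ge[of H] idx_pos[OF that] that by (simp add: q_def os_def field_simps)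
  have "carrier G \<in> os"
    using openin_topspace[of T] subgroup_self by (simp add: os_def topspace_eq_carrier)
  then have ne: "q ` os \<noteq> {}" by blast
  have bdd: "bdd_below (q ` os)" using q_ge by (intro bdd_belowI[of _ r]) auto
  have "r \<le> c" unfolding c_def using q_ge by (intro cInf_greatest[OF ne]) auto
  with r have c: "c > 0" by simp
  have c_le: "c * card (rcosets H) \<le> subgroup_rank H" if "H \<in> os" for H
  proof -
    have "c \<le> q H" unfolding c_def using that bdd by (intro cInf_lower) auto
    then show ?thesis using idx_pos[OF that] by (simp add: q_def field_simps)
  qed
  have q_mono: "q K \<le> q H" if KH: "K \<in> os" "H \<in> os" "K \<subseteq> H" for K H
  proof -
    have K: "subgroup K G" "openin T K" and H: "subgroup H G" "openin T H"
      using KH by (auto simp: os_def)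
    obtain S where S: "top_gen H S" "card S = subgroup_rank H" using gens[OF H] by blast
    obtain S' where S': "top_gen K S'" "card S' \<le> card S * card ((#>) K ` H)"
      using top_gen_open_subgroup[OF K H(1) KH(3) S(1)] by blast
    have "subgroup_rank K \<le> subgroup_rank H * card ((#>) K ` H)"
      using subgroup_rank_le[OF K(1) S'(1)] S'(2) S(2) by simp
    moreover have tower: "card (rcosets K) = card (rcosets H) * card ((#>) K ` H)"
      by (rule card_rcosets_tower[OF K(1) H(1) KH(3) finite_rcosets_open_subgroup[OF K]])
    moreover have "0 < card (rcosets H)" "0 < card ((#>) K ` H)"
      using idx_pos[OF KH(1)] tower by auto
    ultimately show ?thesis
      by (simp add: q_def field_simps flip: of_nat_mult)
  qed
  have l0: "length w0 \<ge> 1" using w0 by (cases w0) (auto simp: words_def)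
  let ?l0 = "length w0"
  \<comment> \<open>The tolerance depends on \<open>k\<close> and \<open>w0\<close> only, since \<open>w\<close>, no longer than \<open>w0\<close>, is found after \<open>H0\<close> is fixed.\<close>
  have "0 < 4 * k * ?l0" using k l0 by (intro mult_pos_pos) linarith+
  then have "0 < 1 / real (4 * k * ?l0)" by (simp only: zero_less_divide_1_iff of_nat_0_less_iff)
  then have "c < c * (1 + 1 / (4 * k * ?l0))"
    using mult_strict_left_mono[of 1 "1 + 1 / real (4 * k * ?l0)" c] c by simp
  then obtain H0 where H0: "H0 \<in> os" "q H0 < c * (1 + 1 / (4 * k * ?l0))"
    using cInf_lessD[OF ne] unfolding c_def by blast
  have "H \<noteq> {\<one>}" if H: "subgroup H G" "openin T H" for H
  proof
    assume eq: "H = {\<one>}"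
    have "\<one> \<in> T closure_of (generate G {})"
      using closure_of_subset[of "generate G {}" T] generate.one[of G "{}"] generate_incl[of "{}"]
      by (auto simp: topspace_eq_carrier)
    then have "top_gen H {}" using eq by (simp add: top_gen_def)
    from subgroup_rank_le[OF H(1) this] have "subgroup_rank H = 0" by simp
    moreover have "r * real (card (rcosets H)) \<ge> 0" using r by simp
    ultimately show False using rank_ge[OF H] by simp
  qed
  moreover obtain m :: nat where m: "8 * k ^ 2 * ?l0 < c * m"
    using reals_Archimedean3[OF c] by (metis mult.commute)
  ultimately obtain H1 where H1: "H1 \<in> os" "H1 \<subseteq> H0" "m \<le> card (rcosets H1)"
    using open_subgroup_of_large_index[of H0 m] H0(1) by (auto simp: os_def)
  have H1': "subgroup H1 G" "openin T H1" using H1 by (auto simp: os_def)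
  obtain w where w: "w \<in> words k" "coset_law G T H1 k w" "length w \<le> ?l0"
    and minimal: "\<And>u. u \<in> words k \<Longrightarrow> length u < length w \<Longrightarrow> \<not> coset_law G T H1 k u"
    using shortest_coset_law[OF w0 law H1'] by blast
  obtain g N where g: "g \<in> {..<k} \<rightarrow> H1" and N: "N \<lhd> G" "openin T N" "N \<subseteq> H1"
    and w_law: "\<And>y. y \<in> {..<k} \<rightarrow> carrier G \<Longrightarrow> (\<forall>i<k. y i \<in> N #> g i) \<Longrightarrow> eval_word G y w = \<one>"
    using w(2) unfolding coset_law_def by blast
  have "\<exists>x K. x \<in> {..<k} \<rightarrow> H1 \<and> (\<forall>i<k. x i \<in> N #> g i) \<and> K \<lhd> G \<and> openin T K \<and> K \<subseteq> N \<and>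
      (\<forall>u \<in> {u \<in> words k. length u < length w}. eval_word G x u \<notin> K)"
    by (rule tuple_avoiding_words[OF H1'(1) g N finite_words_shorter]) (use minimal in auto)
  then obtain x K where x: "x \<in> {..<k} \<rightarrow> H1" "\<forall>i<k. x i \<in> N #> g i" and K: "K \<lhd> G" "openin T K" "K \<subseteq> N"
    and avoid: "\<forall>u \<in> {u \<in> words k. length u < length w}. eval_word G x u \<notin> K"
    by blast
  have Ks: "subgroup K G" and Ns: "subgroup N G" using K(1) N(1) normal_imp_subgroup by blast+
  have xH1: "x ` {..<k} \<subseteq> H1" using x by blast
  then have xc: "x ` {..<k} \<subseteq> carrier G" using subgroup.subset[OF H1'(1)] by blast
  let ?L = "generate G (x ` {..<k})"
  define H where "H = K <#> ?L"
  have Ls: "subgroup ?L G" by (rule generate_is_subgroup[OF xc])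
  have H: "subgroup H G" unfolding H_def by (rule mult_norm_subgroup[OF K(1) Ls])
  have KH: "K \<subseteq> H"
  proof
    fix a assume "a \<in> K"
    then have "a = a \<otimes> \<one>" using subgroup.mem_carrier[OF Ks] by simp
    then show "a \<in> H" using \<open>a \<in> K\<close> generate.one unfolding H_def set_mult_def by blast
  qed
  have LH: "?L \<subseteq> H"
  proof
    fix a assume "a \<in> ?L"
    then have "a = \<one> \<otimes> a" using subgroup.mem_carrier[OF Ls] by simp
    then show "a \<in> H" using \<open>a \<in> ?L\<close> subgroup.one_closed[OF Ks] unfolding H_def set_mult_def by blast
  qed
  have openH: "openin T H" by (rule openin_overgroup[OF H K(2) subgroup.one_closed[OF Ks] KH])
  have HH1: "H \<subseteq> H1"
  proof
    fix z assume "z \<in> H"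
    then obtain a b where "a \<in> K" "b \<in> ?L" "z = a \<otimes> b" by (auto simp: H_def set_mult_def)
    moreover have "?L \<subseteq> H1" by (rule generate_subgroup_incl[OF xH1 H1'(1)])
    ultimately show "z \<in> H1" using K(3) N(3) subgroup.m_closed[OF H1'(1), of a b] by auto
  qed
  have os: "H \<in> os" "K \<in> os" using H openH Ks K(2) by (auto simp: os_def)
  obtain S where S: "top_gen H S" "card S = subgroup_rank H" using gens[OF H openH] by blast
  have xH: "x \<in> {..<k} \<rightarrow> H" using LH by (auto intro: generate.incl)
  have law_K: "eval_word G y w = \<one>"
    if y: "y \<in> {..<k} \<rightarrow> carrier G" "\<And>i. i < k \<Longrightarrow> y i \<in> K #> x i" for y
  proof (rule w_law[OF y(1)], intro allI impI)
    fix i assume i: "i < k"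
    have gi: "g i \<in> carrier G" using g i subgroup.mem_carrier[OF H1'(1)] by auto
    have "y i \<in> N #> x i" using y(2)[OF i] K(3) by (auto simp: r_coset_def)
    also have "N #> x i = N #> g i"
      using repr_independence[OF _ gi Ns] x(2) i by simp
    finally show "y i \<in> N #> g i" .
  qed
  obtain S' \<rho> where S': "top_gen K S'" and n_le: "card ((#>) K ` H) \<le> 2 * length w * \<rho>"
    and saved: "card S' + (card S div k + 1) * \<rho> \<le> card ((#>) K ` H) * ((card S div k + 2) * k)"
    by (rule generators_saved_by_coset_law[OF K(1,2) H KH k xH _ S(1) w(1) law_K])
      (use avoid in \<open>auto simp: H_def\<close>)
  let ?n = "card ((#>) K ` H)" and ?M = "card (rcosets H)"
  have tower: "card (rcosets K) = ?M * ?n"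
    by (rule card_rcosets_tower[OF Ks H KH finite_rcosets_open_subgroup[OF Ks K(2)]])
  show False
  proof (rule saving_contradiction[of k ?l0 ?n c ?M "card S'" "card S" "card S div k + 1" \<rho>])
    show "1 \<le> ?n" using idx_pos[OF os(2)] tower by (cases ?n) auto
    show "c * real (?M * ?n) \<le> real (card S')"
      using c_le[OF os(2)] subgroup_rank_le[OF Ks S'] by (simp add: tower)
    have "q H \<le> q H0" using q_mono[OF os(1) H0(1)] HH1 H1(2) by blast
    then have "q H < c * (1 + 1 / (4 * k * ?l0))" using H0(2) by (rule order_le_less_trans)
    then show "card S < c * (1 + 1 / (4 * k * ?l0)) * ?M"
      using idx_pos[OF os(1)] unfolding q_def S(2) by (simp only: pos_divide_less_eq of_nat_0_less_iff)
    show "card S \<le> k * (card S div k + 1)"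
      using dividend_less_times_div[of k "card S"] k by simp
    show "k * (card S div k + 1) \<le> card S + k" by simp
    show "card S' + (card S div k + 1) * \<rho> \<le> ?n * ((card S div k + 1 + 1) * k)"
      using saved by simp
    show "?n \<le> 2 * ?l0 * \<rho>" using n_le w(3) by (meson le_trans mult_le_mono1 mult_le_mono2)
    have "card (rcosets H) = card (rcosets H1) * card ((#>) H ` H1)"
      by (rule card_rcosets_tower[OF H H1'(1) HH1 finite_rcosets_open_subgroup[OF H openH]])
    then have "card (rcosets H1) \<le> ?M" using idx_pos[OF os(1)] by (cases "card ((#>) H ` H1)") auto
    then have "c * m \<le> c * ?M" using H1(3) c by simp
    then have "real (8 * k ^ 2 * ?l0) < real (card S)" using m c_le[OF os(1)] S(2) by simp
    then show "8 * k ^ 2 * ?l0 < card S" by (simp only: of_nat_less_iff)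
  qed (use k l0 c in auto)
qed

end

theorem theorem1:
  fixes G :: "('a, 'b) monoid_scheme" and T :: "'a topology"
  assumes "profinite_group G T"
    and "top_finitely_generated G T"
    and "rank_gradient G T > 0"
  shows "\<not> satisfies_nontrivial_law G"
proof
  interpret profinite_group G T by (rule assms(1))
  assume "satisfies_nontrivial_law G"
  then obtain k w where "k \<ge> 1" "w \<in> carrier (free_group k)" "w \<noteq> \<one>\<^bsub>free_group k\<^esub>"
    "\<forall>g \<in> {..<k} \<rightarrow> carrier G. eval_word G g w = \<one>\<^bsub>G\<^esub>"
    by (auto simp: satisfies_nontrivial_law_def)
  then show False
    using no_law_of_positive_rank_gradient[OF assms(2,3), of k w]
    by (auto simp: words_def free_group_def)
qed

end
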